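(* There exists a solution to the following discrete minimization problem: find $(\boldsymbol u_h,\boldsymbol n_h)\in\mathcal{A}(\boldsymbol u_{0h},\boldsymbol n_{0h})=K_h\times N_h$ minimizing, over $\mathcal{A}(\boldsymbol u_{0h},\boldsymbol n_{0h})$, the functional $$\Pi(\boldsymbol u,\boldsymbol n)=\int_\Omega\left(|F|^2-(1-a)|F^T\boldsymbol n|^2\right)+b|\nabla\boldsymbol n|^2-\int_\Omega\boldsymbol f\cdot\boldsymbol u-\int_{\Gamma_2}\boldsymbol g\cdot\boldsymbol u\,da,\qquad F=I+\nabla\boldsymbol u.$$
   Context: $\Omega\subset\mathbb{R}^2$ is the domain (nondimensionalized reference configuration of a liquid crystal elastomer) with a triangular mesh, and $\Gamma_0,\Gamma_1,\Gamma_2$ are parts of its boundary $\partial\Omega$. $a\in(0,1)$ is a constant, $b$ is the constant (nondimensionalized) coefficient of the Oseen-Frank energy, $\boldsymbol f$ is the body force and $\boldsymbol g$ the traction force on $\Gamma_2$. $|F|$ is the Frobenius norm. $V_h$ is the space of continuous piecewise linear functions on the mesh and $W_h$ the space of continuous piecewise quadratic functions; $V_{h,0|\Gamma_1}=\{v\in V_h\cap H^1:v=0\text{ on }\Gamma_1\}$ and $W_{h,0|\Gamma_0}=\{w\in W_h\cap H^1:w=0\text{ on }\Gamma_0\}$; boldface $\mathbf{V}_h,\mathbf{W}_h,\mathbf{V}_{h,0|\Gamma_1},\mathbf{W}_{h,0|\Gamma_0}$ denote the $\mathbb{R}^2$-valued versions; $\pi_h$ is the nodal interpolation operator onto $V_h$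 (or $\mathbf{V}_h$). For given discrete boundary data $\boldsymbol u_{0h}\in\mathbf{W}_h$ and $\boldsymbol n_{0h}\in\mathbf{V}_h$, $$K_h=\Big\{\boldsymbol u_h\in\mathbf{W}_{h,0|\Gamma_0}+\boldsymbol u_{0h}:\ \int_\Omega q_h(\det(I+\nabla\boldsymbol u_h)-1)\,dx=0\ \ \forall q_h\in V_h\Big\},$$ $$N_h=\Big\{\boldsymbol n_h\in\mathbf{V}_{h,0|\Gamma_1}+\boldsymbol n_{0h}:\ \int_\Omega\mu_h\,\pi_h(|\boldsymbol n_h|^2-1)\,dx=0\ \ \forall\mu_h\in V_{h,0|\Gamma_1}\Big\}.$$ The function $\pi_h(|\boldsymbol n_h|^2-1)$ is taken to lie in $V_{h,0|\Gamma_1}$, so that $\boldsymbol n_h\in N_h$ if and only if this function is identically $0$, which means $|\boldsymbol n_h|=1$ at all the mesh nodes.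
   Formalization: The formal theorem additionally assumes that K_h is nonempty and that Γ_0 is nonempty; without these K_h may be empty (boundary data enclosing the wrong area) or Π unbounded below under translations. It also takes f and g integrable and Ω equal to the interior of its closure. *)

theory Defs
  imports "HOL-Analysis.Analysis"
begin

text \<open>A conforming triangular mesh of a planar domain. The requirement that \<open>\<Omega>\<close> is the
  interior of its closure excludes slits, so that functions on \<open>\<Omega>\<close> which are continuous up to
  the boundary are the same as continuous functions on the union of the triangles.\<close>

definition triangular_mesh :: "(real^2) set \<Rightarrow> (real^2) set set \<Rightarrow> bool" where
  "triangular_mesh \<Omega> \<T> \<longleftrightarrow>
     triangulation \<T> \<and> (\<forall>T\<in>\<T>. 2 simplex T) \<and>
     \<Union>\<T> = closure \<Omega> \<and> interior (closure \<Omega>) = \<Omega>"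

definition nodes :: "(real^2) set set \<Rightarrow> (real^2) set" where
  "nodes \<T> = {z. \<exists>T\<in>\<T>. z extreme_point_of T}"

text \<open>Finite element spaces, with values in \<open>\<real>\<close> or \<open>\<real>\<^sup>2\<close> according to the type. A finite element
  function is a function on \<open>\<Union>\<T> = closure \<Omega>\<close>; it is represented by its extension by zero, so that
  equality of functions is equality on \<open>closure \<Omega>\<close>. Continuous piecewise polynomials on a mesh
  are automatically of class \<open>H\<^sup>1(\<Omega>)\<close>, which is why intersections of these spaces with \<open>H\<^sup>1\<close> do
  not appear.\<close>

definition V_h :: "(real^2) set set \<Rightarrow> (real^2 \<Rightarrow> 'b::real_normed_vector) set" where
  "V_h \<T> = {v. continuous_on (\<Union>\<T>) v \<and> (\<forall>x. x \<notin> \<Union>\<T> \<longrightarrow> v x = 0) \<and>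
     (\<forall>T\<in>\<T>. \<exists>c L. linear L \<and> (\<forall>x\<in>T. v x = c + L x))}"

definition W_h :: "(real^2) set set \<Rightarrow> (real^2 \<Rightarrow> 'b::real_normed_vector) set" where
  "W_h \<T> = {w. continuous_on (\<Union>\<T>) w \<and> (\<forall>x. x \<notin> \<Union>\<T> \<longrightarrow> w x = 0) \<and>
     (\<forall>T\<in>\<T>. \<exists>c L B. linear L \<and> bilinear B \<and> (\<forall>x\<in>T. w x = c + L x + B x x))}"

definition V_h0 ::
  "(real^2) set set \<Rightarrow> (real^2) set \<Rightarrow> (real^2 \<Rightarrow> 'b::real_normed_vector) set" where
  "V_h0 \<T> \<Gamma> = {v \<in> V_h \<T>. \<forall>x\<in>\<Gamma>. v x = 0}"

definition W_h0 ::
  "(real^2) set set \<Rightarrow> (real^2) set \<Rightarrow> (real^2 \<Rightarrow> 'b::real_normed_vector) set" where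
  "W_h0 \<T> \<Gamma> = {w \<in> W_h \<T>. \<forall>x\<in>\<Gamma>. w x = 0}"

definition translate ::
  "(real^2 \<Rightarrow> 'b::real_normed_vector) set \<Rightarrow> (real^2 \<Rightarrow> 'b) \<Rightarrow> (real^2 \<Rightarrow> 'b) set" where
  "translate S u0 = (\<lambda>v x. v x + u0 x) ` S"

definition nodal_interp ::
  "(real^2) set set \<Rightarrow> (real^2 \<Rightarrow> 'b::real_normed_vector) \<Rightarrow> (real^2 \<Rightarrow> 'b)" where
  "nodal_interp \<T> \<phi> = (THE v. v \<in> V_h \<T> \<and> (\<forall>z\<in>nodes \<T>. v z = \<phi> z))"

text \<open>The gradient of a vector field \<open>u\<close> is the matrix \<open>(\<partial>\<^sub>j u\<^sub>i)\<^sub>i\<^sub>j\<close>. For finite element functions it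
  is the classical gradient in the open triangles; its values on the mesh edges, a null set, are
  irrelevant.\<close>

abbreviation grad :: "(real^2 \<Rightarrow> real^2) \<Rightarrow> real^2 \<Rightarrow> real^2^2" where
  "grad u x \<equiv> jacobian u (at x)"

definition def_grad :: "(real^2 \<Rightarrow> real^2) \<Rightarrow> real^2 \<Rightarrow> real^2^2" where
  "def_grad u x = mat 1 + grad u x"

definition K_h ::
  "(real^2) set \<Rightarrow> (real^2) set set \<Rightarrow> (real^2) set \<Rightarrow> (real^2 \<Rightarrow> real^2) \<Rightarrow> (real^2 \<Rightarrow> real^2) set" where
  "K_h \<Omega> \<T> \<Gamma>0 u0 = {u \<in> translate (W_h0 \<T> \<Gamma>0) u0.
     \<forall>q \<in> V_h \<T>. (LINT x:\<Omega>|lebesgue. q x * (det (def_grad u x) - 1)) = 0}"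

definition N_h ::
  "(real^2) set \<Rightarrow> (real^2) set set \<Rightarrow> (real^2) set \<Rightarrow> (real^2 \<Rightarrow> real^2) \<Rightarrow> (real^2 \<Rightarrow> real^2) set" where
  "N_h \<Omega> \<T> \<Gamma>1 n0 = {n \<in> translate (V_h0 \<T> \<Gamma>1) n0.
     \<forall>\<mu> \<in> V_h0 \<T> \<Gamma>1. (LINT x:\<Omega>|lebesgue. \<mu> x * nodal_interp \<T> (\<lambda>y. (norm (n y))\<^sup>2 - 1) x) = 0}"

text \<open>Arc length on the polygonal boundary: the measure \<open>arclength e\<close> of a segment \<open>e\<close> is the image
  of Lebesgue measure on \<open>[0,1]\<close>, scaled by the length of \<open>e\<close>, under the affine parametrization of
  \<open>e\<close>. It does not depend on which endpoint is chosen as the first one.\<close>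

definition boundary_edges :: "(real^2) set \<Rightarrow> (real^2) set set \<Rightarrow> (real^2) set set" where
  "boundary_edges \<Omega> \<T> = {e. \<exists>T\<in>\<T>. e edge_of T \<and> e \<subseteq> frontier \<Omega>}"

definition arclength :: "(real^2) set \<Rightarrow> (real^2) measure" where
  "arclength e = (let (p, q) = (SOME (p, q). e = closed_segment p q) in
     completion (distr (density lborel (\<lambda>t. ennreal (dist p q) * indicator {0..1} t))
       borel (linepath p q)))"

definition boundary_integral ::
  "(real^2) set \<Rightarrow> (real^2) set set \<Rightarrow> (real^2) set \<Rightarrow> (real^2 \<Rightarrow> real) \<Rightarrow> real" where
  "boundary_integral \<Omega> \<T> \<Gamma> h = (\<Sum>e\<in>boundary_edges \<Omega> \<T>. LINT x:\<Gamma>|arclength e. h x)"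

definition boundary_integrable ::
  "(real^2) set \<Rightarrow> (real^2) set set \<Rightarrow> (real^2) set \<Rightarrow> (real^2 \<Rightarrow> real^2) \<Rightarrow> bool" where
  "boundary_integrable \<Omega> \<T> \<Gamma> h \<longleftrightarrow>
     (\<forall>e\<in>boundary_edges \<Omega> \<T>. set_integrable (arclength e) \<Gamma> h)"

text \<open>The norm of the type \<^typ>\<open>real^2^2\<close> is the Frobenius norm.\<close>

definition energy ::
  "(real^2) set \<Rightarrow> (real^2) set set \<Rightarrow> (real^2) set \<Rightarrow> real \<Rightarrow> real \<Rightarrow>
   (real^2 \<Rightarrow> real^2) \<Rightarrow> (real^2 \<Rightarrow> real^2) \<Rightarrow> (real^2 \<Rightarrow> real^2) \<Rightarrow> (real^2 \<Rightarrow> real^2) \<Rightarrow> real" where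
  "energy \<Omega> \<T> \<Gamma>2 a b f g u n =
     (LINT x:\<Omega>|lebesgue.
        ((norm (def_grad u x))\<^sup>2 - (1 - a) * (norm (transpose (def_grad u x) *v n x))\<^sup>2)
        + b * (norm (grad n x))\<^sup>2)
     - (LINT x:\<Omega>|lebesgue. f x \<bullet> u x)
     - boundary_integral \<Omega> \<T> \<Gamma>2 (\<lambda>x. g x \<bullet> u x)"

end

theory Submission
  imports Defs
begin

text \<open>
  The proof is the direct method of the calculus of variations in finite dimension: every
  minimizing sequence \<open>(u\<^sub>k, n\<^sub>k)\<close> is shown to have a subsequence that converges to an admissible pair
  along which the energy converges to the energy of the limit. The notion of convergence
  (\<open>fe_converges\<close>) is pointwise convergence of the functions and, in the open triangles, of their
  gradients, with uniform bounds. All integrals in the problem pass to the limit by dominated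
  convergence, since the mesh edges form a null set.

  Compactness rests on one dichotomy, \<open>fe_compactness_alternative\<close>. On each triangle a function
  in \<open>W\<^sub>h\<close> is a quadratic polynomial with six coefficients. Either the coefficients of a sequence are
  bounded, and a subsequence converges, or they escape to infinity along a subsequence; in that case
  multiples \<open>s\<^sub>k u\<^sub>k\<close> with \<open>s\<^sub>k \<longlonglongrightarrow> 0\<close> converge to a limit \<open>w\<close> that is not zero, because its
  coefficients have total norm one and a polynomial vanishing on a triangle is zero. The rest of the
  argument rules out escape.

  For the directors: testing the constraint with \<open>\<mu>\<^sub>h = \<pi>\<^sub>h(|n\<^sub>h|\<^sup>2 - 1)\<close> itself shows
  that \<open>N\<^sub>h\<close> consists of the functions with the right values on \<open>\<Gamma>\<^sub>1\<close> and \<open>|n\<^sub>h| = 1\<close> at the nodes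
  (\<open>N_h_iff\<close>). An affine interpolant of unit vectors has norm at most one, so a rescaled
  sequence tends to zero and the sequence cannot escape. With bounded
  coefficients the director gradients are bounded too, and so is the term with \<open>b\<close>.

  For the displacements: since \<open>|n| \<le> 1\<close>, the density is bounded below by \<open>a |F|\<^sup>2\<close> up to the
  director term. If the displacements escaped while the energy stayed bounded above, then
  multiplying the energy by \<open>s\<^sub>k\<^sup>2\<close> and passing to the limit would leave only the quadratic part,
  so \<open>a \<integral>|\<nabla>w|\<^sup>2 \<le> 0\<close>. Then \<open>w\<close> is constant on each triangle, hence constant on the
  connected domain, and it vanishes at a point of \<open>\<Gamma>\<^sub>0\<close>, because \<open>s\<^sub>k u\<^sub>k = s\<^sub>k u\<^sub>0 \<longlonglongrightarrow> 0\<close> there.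
  This contradicts \<open>w \<noteq> 0\<close>.

  That \<open>N\<^sub>h\<close> has an element has to be proved: the hypothesis that \<open>\<pi>\<^sub>h(|n|\<^sup>2 - 1)\<close> vanishes
  on \<open>\<Gamma>\<^sub>1\<close> for every \<open>n\<close> with the boundary values of \<open>n\<^sub>0\<close> implies that the values on \<open>\<Gamma>\<^sub>1\<close> determine
  those at all vertices with positive barycentric coordinates at some point of \<open>\<Gamma>\<^sub>1\<close>, and that
  \<open>|n\<^sub>0| = 1\<close> at these vertices (\<open>N_h_nonempty\<close>). The other nodal values may be any unit vectors.
\<close>

section \<open>Quadratic polynomials in the plane\<close>

text \<open>Piecewise quadratic functions are handled through their six vector coefficients on each triangle
in the monomial basis. The coefficients form a Euclidean space, so bounded sequences of them have
convergent subsequences.\<close>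

type_synonym coeffs =
  "(real^2) \<times> (real^2) \<times> (real^2) \<times> (real^2) \<times> (real^2) \<times> (real^2)"

definition quad :: "coeffs \<Rightarrow> real^2 \<Rightarrow> real^2" where
  "quad = (\<lambda>(c0, c1, c2, c3, c4, c5) x. c0 + x$1 *\<^sub>R c1 + x$2 *\<^sub>R c2
     + (x$1 * x$1) *\<^sub>R c3 + (x$1 * x$2) *\<^sub>R c4 + (x$2 * x$2) *\<^sub>R c5)"

definition quad_deriv :: "coeffs \<Rightarrow> real^2 \<Rightarrow> real^2 \<Rightarrow> real^2" where
  "quad_deriv = (\<lambda>(c0, c1, c2, c3, c4, c5) x h. h$1 *\<^sub>R c1 + h$2 *\<^sub>R c2
     + (2 * x$1 * h$1) *\<^sub>R c3 + (x$1 * h$2 + x$2 * h$1) *\<^sub>R c4 + (2 * x$2 * h$2) *\<^sub>R c5)"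

lemma continuous_on_quad:
  assumes "continuous_on A f" "continuous_on A g"
  shows "continuous_on A (\<lambda>x. quad (f x) (g x))"
  unfolding quad_def case_prod_beta by (intro continuous_intros assms)

lemma continuous_on_matrix_quad_deriv:
  assumes "continuous_on A f" "continuous_on A g"
  shows "continuous_on A (\<lambda>x. matrix (quad_deriv (f x) (g x)))"
  unfolding matrix_def quad_deriv_def case_prod_beta
  by (intro continuous_intros continuous_on_vec_lambda assms)

lemma has_derivative_quad: "(quad \<theta> has_derivative quad_deriv \<theta> x) (at x within A)"
proof -
  obtain c0 c1 c2 c3 c4 c5 where \<theta>: "\<theta> = (c0, c1, c2, c3, c4, c5)" by (cases \<theta>)
  have [derivative_intros]: "((\<lambda>x::real^2. x $ i) has_derivative (\<lambda>h. h $ i)) (at x within A)" for i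
    by (rule bounded_linear_imp_has_derivative[OF bounded_linear_vec_nth])
  show ?thesis
    unfolding \<theta> quad_def quad_deriv_def prod.case
    by (auto intro!: derivative_eq_intros simp: fun_eq_iff algebra_simps)
qed

lemma quad_scaleR: "quad (s *\<^sub>R \<theta>) x = s *\<^sub>R quad \<theta> x"
  by (cases \<theta>) (simp add: quad_def algebra_simps)

text \<open>Evaluating at a point \<open>z\<close> and at nearby points \<open>z + i s e\<^sub>1 + j s e\<^sub>2\<close> with \<open>i, j\<close> among
  \<open>0, 1, -1\<close> gives six linear equations; second differences isolate the three quadratic coefficients,
  then first differences the two linear ones.\<close>

lemma quad_eq_0_imp:
  assumes A: "interior A \<noteq> {}" and 0: "\<And>x. x \<in> A \<Longrightarrow> quad \<theta> x = 0"
  shows "\<theta> = 0"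
proof -
  obtain c0 c1 c2 c3 c4 c5 where \<theta>: "\<theta> = (c0, c1, c2, c3, c4, c5)" by (cases \<theta>)
  obtain z t where t: "t > 0" and ball: "cball z t \<subseteq> A"
    using A by (meson ex_in_conv mem_interior_cball)
  \<comment> \<open>The factor \<open>1/2\<close> keeps the diagonal points, where both coordinates move, in the ball.\<close>
  define s where "s = t / 2"
  have s: "s > 0" using t by (simp add: s_def)
  define P where "P i j = z + ((i * s) *\<^sub>R axis 1 1 + (j * s) *\<^sub>R axis 2 1)" for i j :: real
  have P: "quad \<theta> (P i j) = 0" if "\<bar>i\<bar> \<le> 1" "\<bar>j\<bar> \<le> 1" for i j
  proof -
    have "norm ((i * s) *\<^sub>R axis 1 1 + (j * s) *\<^sub>R axis 2 1 :: real^2) \<le> \<bar>i\<bar> * s + \<bar>j\<bar> * s"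
      using s by (intro norm_triangle_le) (simp add: abs_mult)
    also have "\<dots> \<le> 1 * s + 1 * s" using that s by (intro add_mono mult_right_mono) auto
    also have "\<dots> = t" by (simp add: s_def)
    finally have "P i j \<in> cball z t" unfolding P_def mem_cball by (metis add_diff_cancel_left' dist_norm dist_commute)
    then show ?thesis using 0 ball by blast
  qed
  have [simp]: "P i j $ 1 = z$1 + i * s" "P i j $ 2 = z$2 + j * s" for i j
    by (simp_all add: P_def axis_def)
  have comp: "c0 $ k = 0 \<and> c1 $ k = 0 \<and> c2 $ k = 0 \<and> c3 $ k = 0 \<and> c4 $ k = 0 \<and> c5 $ k = 0" for k
  proof -
    have q: "c0$k + (z$1 + i * s) * c1$k + (z$2 + j * s) * c2$k + (z$1 + i * s) * (z$1 + i * s) * c3$k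
        + (z$1 + i * s) * (z$2 + j * s) * c4$k + (z$2 + j * s) * (z$2 + j * s) * c5$k = 0"
      if "\<bar>i\<bar> \<le> 1" "\<bar>j\<bar> \<le> 1" for i j
      using arg_cong[OF P[OF that], of "\<lambda>v. v $ k"] by (simp add: \<theta> quad_def)
    have "2 * (s * s) * c3$k = 0"
      using q[of 0 0] q[of 1 0] q[of "-1" 0] by simp algebra
    then have c3: "c3$k = 0" using s by simp
    have "2 * (s * s) * c5$k = 0"
      using q[of 0 0] q[of 0 1] q[of 0 "-1"] by simp algebra
    then have c5: "c5$k = 0" using s by simp
    have "s * s * c4$k = 0"
      using q[of 0 0] q[of 1 0] q[of 0 1] q[of 1 1] by (simp add: c3 c5) algebra
    then have c4: "c4$k = 0" using s by simp
    have "s * c1$k = 0"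
      using q[of 0 0] q[of 1 0] by (simp add: c3 c4 c5) algebra
    then have c1: "c1$k = 0" using s by simp
    have "s * c2$k = 0"
      using q[of 0 0] q[of 0 1] by (simp add: c1 c3 c4 c5) algebra
    then have c2: "c2$k = 0" using s by simp
    show ?thesis using q[of 0 0] by (simp add: c1 c2 c3 c4 c5)
  qed
  then show ?thesis by (simp add: \<theta> vec_eq_iff zero_prod_def)
qed

text \<open>The coordinate-free form of the quadratics and the monomial form are related by expanding \<open>x\<close> in
the standard basis; the mixed coefficient is \<open>B e\<^sub>1 e\<^sub>2 + B e\<^sub>2 e\<^sub>1\<close> because \<open>B\<close> need not be
symmetric.\<close>

lemma ex_quad_iff:
  "(\<exists>c L B. linear L \<and> bilinear B \<and> (\<forall>x\<in>T. w x = c + L x + B x x)) \<longleftrightarrow>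
   (\<exists>\<theta>. \<forall>x\<in>T. w x = quad \<theta> x)" (is "?l = ?r")
proof
  assume ?l
  then obtain c L B where L: "linear L" and B: "bilinear B"
    and w: "\<And>x. x \<in> T \<Longrightarrow> w x = c + L x + B x x" by blast
  let ?e1 = "axis 1 1 :: real^2" and ?e2 = "axis 2 1 :: real^2"
  let ?\<theta> = "(c, L ?e1, L ?e2, B ?e1 ?e1, B ?e1 ?e2 + B ?e2 ?e1, B ?e2 ?e2)"
  have "w x = quad ?\<theta> x" if "x \<in> T" for x
  proof -
    have x: "x = x$1 *\<^sub>R ?e1 + x$2 *\<^sub>R ?e2" by (simp add: vec_eq_iff axis_def forall_2)
    have "L x = x$1 *\<^sub>R L ?e1 + x$2 *\<^sub>R L ?e2"
      by (subst x) (simp only: linear_add[OF L] linear_scale[OF L])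
    moreover have "B x x = (x$1 * x$1) *\<^sub>R B ?e1 ?e1
        + (x$1 * x$2) *\<^sub>R (B ?e1 ?e2 + B ?e2 ?e1) + (x$2 * x$2) *\<^sub>R B ?e2 ?e2"
      by (subst (1 2) x) (simp add: bilinear_ladd[OF B] bilinear_radd[OF B] bilinear_lmul[OF B]
          bilinear_rmul[OF B] scaleR_add_right mult.commute)
    ultimately show ?thesis using w[OF that] by (simp add: quad_def)
  qed
  then show ?r by blast
next
  assume ?r
  then obtain \<theta> where w: "\<And>x. x \<in> T \<Longrightarrow> w x = quad \<theta> x" by blast
  obtain c0 c1 c2 c3 c4 c5 where \<theta>: "\<theta> = (c0, c1, c2, c3, c4, c5)" by (cases \<theta>)
  let ?L = "\<lambda>x::real^2. x$1 *\<^sub>R c1 + x$2 *\<^sub>R c2"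
  let ?B = "\<lambda>x y::real^2. (x$1 * y$1) *\<^sub>R c3 + (x$1 * y$2) *\<^sub>R c4 + (x$2 * y$2) *\<^sub>R c5"
  have "linear ?L" by (intro linearI) (simp_all add: algebra_simps)
  moreover have "bilinear ?B"
    unfolding bilinear_def by (intro conjI allI linearI) (simp_all add: algebra_simps)
  moreover have "\<forall>x\<in>T. w x = c0 + ?L x + ?B x x" by (simp add: w \<theta> quad_def)
  ultimately show ?l by blast
qed

lemma finite_family_convergent_subsequence:
  fixes \<theta> :: "nat \<Rightarrow> 'i \<Rightarrow> 'a::heine_borel"
  assumes "finite I" "\<forall>i\<in>I. bounded (range (\<lambda>k. \<theta> k i))"
  shows "\<exists>r l. strict_mono r \<and> (\<forall>i\<in>I. (\<lambda>k. \<theta> (r k) i) \<longlonglongrightarrow> l i)"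
  using assms
proof (induction I)
  case empty
  show ?case using strict_mono_id by blast
next
  case (insert i I)
  then obtain r l where r: "strict_mono r" "\<forall>j\<in>I. (\<lambda>k. \<theta> (r k) j) \<longlonglongrightarrow> l j"
    by (metis insertI2)
  have "bounded (range (\<lambda>k. \<theta> (r k) i))"
    using insert.prems by (auto intro: bounded_subset)
  then obtain y q where q: "strict_mono q" "((\<lambda>k. \<theta> (r k) i) \<circ> q) \<longlonglongrightarrow> y"
    using bounded_imp_convergent_subsequence by blast
  have "(\<lambda>k. \<theta> ((r \<circ> q) k) j) \<longlonglongrightarrow> (l(i := y)) j" if "j \<in> insert i I" for j
    using that q(2) LIMSEQ_subseq_LIMSEQ[OF r(2)[rule_format] q(1)] by (auto simp: o_def)
  then show ?case using strict_mono_o[OF r(1) q(1)] by blast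
qed

section \<open>Conforming meshes and nodal interpolation\<close>

text \<open>Differences of affinely independent points are linearly independent, so a linear map may be
  prescribed on them.\<close>

lemma affinely_independent_interpolation:
  fixes C :: "'a::euclidean_space set" and \<phi> :: "'a \<Rightarrow> 'b::real_normed_vector"
  assumes "\<not> affine_dependent C"
  shows "\<exists>c L. linear L \<and> (\<forall>z\<in>C. c + L z = \<phi> z)"
proof (cases "C = {}")
  case True
  then show ?thesis using linear_zero by blast
next
  case False
  then obtain a where a: "a \<in> C" by blast
  \<comment> \<open>Edge vectors from a base vertex, on which the linear part is prescribed.\<close>
  have "independent ((\<lambda>x. -a + x) ` (C - {a}))"
    using assms affine_dependent_iff_dependent2[OF a] by blast
  from linear_independent_extend[OF this, of "\<lambda>d. \<phi> (a + d) - \<phi> a"]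
  obtain L where L: "linear L" and ext: "\<forall>d\<in>(\<lambda>x. -a + x) ` (C - {a}). L d = \<phi> (a + d) - \<phi> a"
    by blast
  have "(\<phi> a - L a) + L z = \<phi> z" if "z \<in> C" for z
  proof (cases "z = a")
    case False
    then have "L (-a + z) = \<phi> z - \<phi> a" using ext that by auto
    then show ?thesis by (simp add: linear_diff[OF L] algebra_simps)
  qed simp
  then show ?thesis using L by blast
qed

lemma affine_functions_eq_on_convex_hull:
  fixes L L' :: "'a::real_vector \<Rightarrow> 'b::real_vector"
  assumes L: "linear L" "linear L'" and eq: "\<And>z. z \<in> S \<Longrightarrow> c + L z = c' + L' z"
    and x: "x \<in> convex hull S"
  shows "c + L x = c' + L' x"
proof -
  have "convex {x. c + L x = c' + L' x}"
  proof (rule convexI, unfold mem_Collect_eq)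
    fix x y and u v :: real
    assume xy: "c + L x = c' + L' x" "c + L y = c' + L' y" and uv: "u + v = 1"
    have "c + L (u *\<^sub>R x + v *\<^sub>R y) = (u + v) *\<^sub>R c + L (u *\<^sub>R x + v *\<^sub>R y)" using uv by simp
    also have "\<dots> = u *\<^sub>R (c + L x) + v *\<^sub>R (c + L y)"
      by (simp add: linear_add[OF L(1)] linear_scale[OF L(1)] algebra_simps)
    also have "\<dots> = u *\<^sub>R (c' + L' x) + v *\<^sub>R (c' + L' y)" by (simp only: xy)
    also have "\<dots> = (u + v) *\<^sub>R c' + L' (u *\<^sub>R x + v *\<^sub>R y)"
      by (simp add: linear_add[OF L(2)] linear_scale[OF L(2)] algebra_simps)
    finally show "c + L (u *\<^sub>R x + v *\<^sub>R y) = c' + L' (u *\<^sub>R x + v *\<^sub>R y)" using uv by simp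
  qed
  then have "convex hull S \<subseteq> {x. c + L x = c' + L' x}"
    using eq by (intro hull_minimal) auto
  then show ?thesis using x by blast
qed

locale planar_mesh =
  fixes \<Omega> :: "(real^2) set" and \<T> :: "(real^2) set set"
  assumes mesh: "triangular_mesh \<Omega> \<T>"
begin

lemma finite_mesh: "finite \<T>"
  and Union_mesh: "\<Union>\<T> = closure \<Omega>"
  and interior_closure: "interior (closure \<Omega>) = \<Omega>"
  using mesh by (auto simp: triangular_mesh_def triangulation_def)

lemma open_domain: "open \<Omega>"
  using interior_closure open_interior by metis

definition vertices :: "(real^2) set \<Rightarrow> (real^2) set" where
  "vertices T = {z. z extreme_point_of T}"

lemma nodes_eq: "nodes \<T> = (\<Union>T\<in>\<T>. vertices T)"
  by (auto simp: nodes_def vertices_def)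

context
  fixes T assumes T: "T \<in> \<T>"
begin

lemma triangle:
  "\<not> affine_dependent (vertices T)" "T = convex hull vertices T" "aff_dim T = 2"
proof -
  have "2 simplex T" using mesh T by (auto simp: triangular_mesh_def)
  then obtain C where C: "\<not> affine_dependent C" "T = convex hull C"
    by (auto simp: simplex_def)
  have "vertices T = C"
    using extreme_point_of_convex_hull_affine_independent[OF C(1)] by (auto simp: vertices_def C(2))
  then show "\<not> affine_dependent (vertices T)" "T = convex hull vertices T" using C by auto
  show "aff_dim T = 2" using \<open>2 simplex T\<close> by (rule aff_dim_simplex)
qed

lemma finite_vertices: "finite (vertices T)"
  using aff_independent_finite triangle(1) by blast

lemma compact_triangle: "compact T" and convex_triangle: "convex T"
proof -
  show "compact T" by (subst triangle(2)) (simp add: finite_imp_compact_convex_hull finite_vertices)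
  show "convex T" by (subst triangle(2)) (rule convex_convex_hull)
qed

lemma interior_triangle_nonempty: "interior T \<noteq> {}"
proof -
  have "T \<noteq> {}" using triangle(3) by auto
  then have "rel_interior T \<noteq> {}" using convex_triangle by (simp add: rel_interior_eq_empty)
  then show ?thesis using interior_rel_interior_gen[of T] triangle(3) by simp
qed

lemma vertices_subset: "vertices T \<subseteq> T"
  by (auto simp: vertices_def extreme_point_of_def)

end

text \<open>An element of \<open>V\<^sub>h\<close> is affine on each triangle, so it is determined there by its values at the
vertices: this is what reduces statements about directors to statements about nodal values.\<close>

lemma V_h_affine_combination:
  assumes v: "v \<in> V_h \<T>" and T: "T \<in> \<T>" and "finite S" "S \<subseteq> T"
    and \<alpha>: "\<And>z. z \<in> S \<Longrightarrow> 0 \<le> \<alpha> z" "sum \<alpha> S = 1"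
  shows "v (\<Sum>z\<in>S. \<alpha> z *\<^sub>R z) = (\<Sum>z\<in>S. \<alpha> z *\<^sub>R v z)"
proof -
  from v T obtain c L where L: "linear L" and eq: "\<And>x. x \<in> T \<Longrightarrow> v x = c + L x"
    unfolding V_h_def by blast
  have "(\<Sum>z\<in>S. \<alpha> z *\<^sub>R z) \<in> T"
    by (rule convex_sum) (use assms convex_triangle[OF T] in auto)
  then have "v (\<Sum>z\<in>S. \<alpha> z *\<^sub>R z) = c + (\<Sum>z\<in>S. \<alpha> z *\<^sub>R L z)"
    by (simp add: eq linear_sum[OF L] linear_scale[OF L])
  also have "c = (\<Sum>z\<in>S. \<alpha> z *\<^sub>R c)" by (simp add: \<alpha>(2) flip: scaleR_sum_left)
  also have "\<dots> + (\<Sum>z\<in>S. \<alpha> z *\<^sub>R L z) = (\<Sum>z\<in>S. \<alpha> z *\<^sub>R v z)"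
    using \<open>S \<subseteq> T\<close> by (auto simp: eq scaleR_add_right simp flip: sum.distrib intro!: sum.cong)
  finally show ?thesis .
qed

lemma barycentric_coordinates:
  assumes T: "T \<in> \<T>" "x \<in> T"
  obtains \<alpha> where "\<forall>z\<in>vertices T. 0 \<le> \<alpha> z" "sum \<alpha> (vertices T) = 1"
    "x = (\<Sum>z\<in>vertices T. \<alpha> z *\<^sub>R z)"
proof -
  have "x \<in> convex hull vertices T" using T triangle(2) by blast
  then show thesis unfolding convex_hull_finite[OF finite_vertices[OF T(1)]] using that by blast
qed

lemma V_h_barycentric:
  assumes "v \<in> V_h \<T>" "T \<in> \<T>" "\<forall>z\<in>vertices T. 0 \<le> \<alpha> z" "sum \<alpha> (vertices T) = 1"
  shows "v (\<Sum>z\<in>vertices T. \<alpha> z *\<^sub>R z) = (\<Sum>z\<in>vertices T. \<alpha> z *\<^sub>R v z)"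
  by (rule V_h_affine_combination)
    (use assms in \<open>auto intro: finite_vertices dest: vertices_subset\<close>)

lemma V_h_eqI:
  assumes v: "v \<in> V_h \<T>" "w \<in> V_h \<T>" and eq: "\<And>z. z \<in> nodes \<T> \<Longrightarrow> v z = w z"
  shows "v = w"
proof
  fix x
  show "v x = w x"
  proof (cases "x \<in> \<Union>\<T>")
    case True
    then obtain T where T: "T \<in> \<T>" "x \<in> T" by blast
    obtain \<alpha> where \<alpha>: "\<forall>z\<in>vertices T. 0 \<le> \<alpha> z" "sum \<alpha> (vertices T) = 1"
      "x = (\<Sum>z\<in>vertices T. \<alpha> z *\<^sub>R z)" using barycentric_coordinates[OF T] by blast
    show ?thesis
      unfolding \<alpha>(3) V_h_barycentric[OF v(1) T(1) \<alpha>(1,2)] V_h_barycentric[OF v(2) T(1) \<alpha>(1,2)]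
      using T(1) by (intro sum.cong refl arg_cong[of _ _ "scaleR _"] eq) (auto simp: nodes_eq)
  qed (use v in \<open>auto simp: V_h_def\<close>)
qed

text \<open>The affine interpolants on two triangles have to agree on the common part. The mesh is conforming,
so this part is a face of both triangles; by the Krein--Milman theorem it is the convex hull of its
extreme points, and these are vertices of both triangles, where both interpolants have the
prescribed values.\<close>

lemma ex_nodal_interpolant: "\<exists>v \<in> V_h \<T>. \<forall>z\<in>nodes \<T>. v z = \<phi> z"
  for \<phi> :: "real^2 \<Rightarrow> 'b::real_normed_vector"
proof -
  have "\<forall>T\<in>\<T>. \<exists>c L. linear L \<and> (\<forall>z\<in>vertices T. c + L z = \<phi> z)"
    using affinely_independent_interpolation triangle(1) by blast
  then obtain c L where L: "\<And>T. T \<in> \<T> \<Longrightarrow> linear (L T)"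
    and eq: "\<And>T z. T \<in> \<T> \<Longrightarrow> z \<in> vertices T \<Longrightarrow> c T + L T z = \<phi> z" by metis
  have consistent: "c T + L T x = c T' + L T' x"
    if TT': "T \<in> \<T>" "T' \<in> \<T>" and x: "x \<in> T" "x \<in> T'" for T T' x
  proof -
    have face: "T \<inter> T' face_of T" "T \<inter> T' face_of T'"
      using mesh TT' by (auto simp: triangular_mesh_def triangulation_def) (metis Int_commute)
    have "T \<inter> T' = convex hull {z. z extreme_point_of (T \<inter> T')}"
      using TT' by (intro Krein_Milman_Minkowski compact_Int convex_Int compact_triangle convex_triangle)
    moreover have "{z. z extreme_point_of (T \<inter> T')} \<subseteq> vertices T \<inter> vertices T'"
      using extreme_point_of_face[OF face(1)] extreme_point_of_face[OF face(2)]
      by (auto simp: vertices_def)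
    ultimately have "x \<in> convex hull (vertices T \<inter> vertices T')"
      using x hull_mono by blast
    then show ?thesis
      by (rule affine_functions_eq_on_convex_hull[OF L[OF TT'(1)] L[OF TT'(2)], rotated])
        (auto simp: eq TT')
  qed
  define v where
    "v x = (if x \<in> \<Union>\<T> then let T = (SOME T. T \<in> \<T> \<and> x \<in> T) in c T + L T x else 0)" for x
  have v: "v x = c T + L T x" if "T \<in> \<T>" "x \<in> T" for T x
  proof -
    define T' where "T' = (SOME T. T \<in> \<T> \<and> x \<in> T)"
    have "T' \<in> \<T> \<and> x \<in> T'" unfolding T'_def by (rule someI[of _ T]) (use that in blast)
    moreover have "v x = c T' + L T' x" using that by (auto simp: v_def Let_def T'_def)
    ultimately show ?thesis using consistent[of T' T x] that by simp
  qed
  have "continuous_on (\<Union>T\<in>\<T>. T) v"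
  proof (rule continuous_on_closed_Union[OF finite_mesh])
    fix T assume T: "T \<in> \<T>"
    show "closed T" using compact_triangle[OF T] by (rule compact_imp_closed)
    have "continuous_on T (\<lambda>x. c T + L T x)"
      using L[OF T] by (intro continuous_on_add continuous_on_const linear_continuous_on)
        (simp add: linear_conv_bounded_linear)
    then show "continuous_on T v" by (rule continuous_on_eq) (simp add: v[OF T])
  qed
  then have "v \<in> V_h \<T>"
    unfolding V_h_def using v L by (intro CollectI conjI ballI) (auto simp: v_def, blast)
  moreover have "v z = \<phi> z" if "z \<in> nodes \<T>" for z
  proof -
    from that obtain T where "T \<in> \<T>" "z \<in> vertices T" by (auto simp: nodes_eq)
    then show ?thesis using v[of T z] eq vertices_subset by auto
  qed
  ultimately show ?thesis by blast
qed

lemma nodal_interp: "nodal_interp \<T> \<phi> \<in> V_h \<T> \<and> (\<forall>z\<in>nodes \<T>. nodal_interp \<T> \<phi> z = \<phi> z)"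
  for \<phi> :: "real^2 \<Rightarrow> 'b::real_normed_vector"
proof -
  have "\<exists>!v. v \<in> V_h \<T> \<and> (\<forall>z\<in>nodes \<T>. v z = \<phi> z)"
    using ex_nodal_interpolant[of \<phi>] V_h_eqI by (metis (no_types, lifting))
  from theI'[OF this] show ?thesis by (simp add: nodal_interp_def)
qed

lemmas nodal_interp_in_V_h = nodal_interp[THEN conjunct1]
lemmas nodal_interp_at_node = nodal_interp[THEN conjunct2, rule_format]

text \<open>Convexity of the norm: the value at a point of a triangle is a convex combination of the values
at the vertices.\<close>

lemma V_h_norm_le:
  assumes v: "v \<in> V_h \<T>" and le: "\<And>z. z \<in> nodes \<T> \<Longrightarrow> norm (v z) \<le> M"
    and x: "x \<in> \<Union>\<T>"
  shows "norm (v x) \<le> M"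
proof -
  obtain T where T: "T \<in> \<T>" "x \<in> T" using x by blast
  obtain \<alpha> where \<alpha>: "\<forall>z\<in>vertices T. 0 \<le> \<alpha> z" "sum \<alpha> (vertices T) = 1"
    "x = (\<Sum>z\<in>vertices T. \<alpha> z *\<^sub>R z)" using barycentric_coordinates[OF T] by blast
  have "norm (v x) \<le> (\<Sum>z\<in>vertices T. \<alpha> z * norm (v z))"
    unfolding \<alpha>(3) V_h_barycentric[OF v T(1) \<alpha>(1,2)]
    using \<alpha>(1) by (intro sum_norm_le) simp
  also have "\<dots> \<le> (\<Sum>z\<in>vertices T. \<alpha> z * M)"
    using \<alpha>(1) T(1) le by (intro sum_mono mult_left_mono) (auto simp: nodes_eq)
  also have "\<dots> = M" using \<alpha>(2) by (simp flip: sum_distrib_right)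
  finally show ?thesis .
qed

lemma V_h_subset_W_h: "V_h \<T> \<subseteq> W_h \<T>"
proof
  fix v :: "real^2 \<Rightarrow> 'b::real_normed_vector" assume v: "v \<in> V_h \<T>"
  have "\<exists>c L B. linear L \<and> bilinear B \<and> (\<forall>x\<in>T. v x = c + L x + B x x)" if T: "T \<in> \<T>" for T
  proof -
    obtain c L where "linear L" "\<forall>x\<in>T. v x = c + L x" using v T unfolding V_h_def by blast
    moreover have "bilinear (\<lambda>x y::real^2. 0 :: 'b)" by (simp add: bilinear_def linear_zero)
    ultimately show ?thesis by (metis add.right_neutral)
  qed
  then show "v \<in> W_h \<T>" using v by (simp add: V_h_def W_h_def)
qed

lemma V_h_add: "v \<in> V_h \<T> \<Longrightarrow> w \<in> V_h \<T> \<Longrightarrow> (\<lambda>x. v x + w x) \<in> V_h \<T>"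
proof -
  assume v: "v \<in> V_h \<T>" and w: "w \<in> V_h \<T>"
  have "\<exists>c L. linear L \<and> (\<forall>x\<in>T. v x + w x = c + L x)" if T: "T \<in> \<T>" for T
  proof -
    obtain c L where L: "linear L" "\<forall>x\<in>T. v x = c + L x" using v T unfolding V_h_def by blast
    obtain c' L' where L': "linear L'" "\<forall>x\<in>T. w x = c' + L' x" using w T unfolding V_h_def by blast
    have "linear (\<lambda>x. L x + L' x)" using L L' by (intro linear_compose_add)
    moreover have "\<forall>x\<in>T. v x + w x = (c + c') + (L x + L' x)" using L L' by simp
    ultimately show ?thesis by (intro exI conjI)
  qed
  then show ?thesis using v w by (auto simp: V_h_def intro: continuous_on_add)
qed

lemma V_h_linear_image:
  assumes h: "bounded_linear h" and v: "v \<in> V_h \<T>"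
  shows "(\<lambda>x. h (v x)) \<in> V_h \<T>"
proof -
  interpret h: bounded_linear h by (rule h)
  have "\<exists>c L. linear L \<and> (\<forall>x\<in>T. h (v x) = c + L x)" if T: "T \<in> \<T>" for T
  proof -
    obtain c L where L: "linear L" "\<forall>x\<in>T. v x = c + L x" using v T unfolding V_h_def by blast
    have "linear (h \<circ> L)" using L(1) h.linear_axioms by (rule linear_compose)
    moreover have "\<forall>x\<in>T. h (v x) = h c + (h \<circ> L) x" using L by (simp add: h.add)
    ultimately show ?thesis by blast
  qed
  then show ?thesis using v by (auto simp: V_h_def h.zero intro: h.continuous_on)
qed

lemma W_h_diff: "v \<in> W_h \<T> \<Longrightarrow> w \<in> W_h \<T> \<Longrightarrow> (\<lambda>x. v x - w x) \<in> W_h \<T>"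
  and W_h_add: "v \<in> W_h \<T> \<Longrightarrow> w \<in> W_h \<T> \<Longrightarrow> (\<lambda>x. v x + w x) \<in> W_h \<T>"
proof -
  assume v: "v \<in> W_h \<T>" and w: "w \<in> W_h \<T>"
  have "(\<exists>c L B. linear L \<and> bilinear B \<and> (\<forall>x\<in>T. v x - w x = c + L x + B x x)) \<and>
        (\<exists>c L B. linear L \<and> bilinear B \<and> (\<forall>x\<in>T. v x + w x = c + L x + B x x))" if T: "T \<in> \<T>" for T
  proof -
    obtain c L B where L: "linear L" "bilinear B" "\<forall>x\<in>T. v x = c + L x + B x x"
      using v T unfolding W_h_def by blast
    obtain c' L' B' where L': "linear L'" "bilinear B'" "\<forall>x\<in>T. w x = c' + L' x + B' x x"
      using w T unfolding W_h_def by blast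
    have 1: "linear (\<lambda>x. L x - L' x)" "linear (\<lambda>x. L x + L' x)"
      using L L' by (auto intro: linear_compose_sub linear_compose_add)
    have 2: "bilinear (\<lambda>x y. B x y - B' x y)" "bilinear (\<lambda>x y. B x y + B' x y)"
      using L(2) L'(2) unfolding bilinear_def by (auto intro: linear_compose_sub linear_compose_add)
    have 3: "\<forall>x\<in>T. v x - w x = (c - c') + (L x - L' x) + (B x x - B' x x)"
      "\<forall>x\<in>T. v x + w x = (c + c') + (L x + L' x) + (B x x + B' x x)" using L L' by auto
    show ?thesis
      using 1(1) 2(1) 3(1) 1(2) 2(2) 3(2) by (intro conjI exI)
  qed
  then show "(\<lambda>x. v x - w x) \<in> W_h \<T>" "(\<lambda>x. v x + w x) \<in> W_h \<T>"
    using v w by (auto simp: W_h_def intro: continuous_on_add continuous_on_diff)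
qed

lemma translate_W_h0:
  assumes "u0 \<in> W_h \<T>"
  shows "u \<in> translate (W_h0 \<T> \<Gamma>) u0 \<longleftrightarrow> u \<in> W_h \<T> \<and> (\<forall>x\<in>\<Gamma>. u x = u0 x)"
proof
  assume "u \<in> W_h \<T> \<and> (\<forall>x\<in>\<Gamma>. u x = u0 x)"
  then have "(\<lambda>x. u x - u0 x) \<in> W_h0 \<T> \<Gamma>" using assms by (simp add: W_h0_def W_h_diff)
  then show "u \<in> translate (W_h0 \<T> \<Gamma>) u0" unfolding translate_def by force
qed (use assms in \<open>auto simp: translate_def W_h0_def W_h_add\<close>)

lemma translate_V_h0:
  assumes "n0 \<in> V_h \<T>"
  shows "n \<in> translate (V_h0 \<T> \<Gamma>) n0 \<longleftrightarrow> n \<in> V_h \<T> \<and> (\<forall>x\<in>\<Gamma>. n x = n0 x)"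
proof
  assume n: "n \<in> V_h \<T> \<and> (\<forall>x\<in>\<Gamma>. n x = n0 x)"
  have "(\<lambda>x. n x + - n0 x) \<in> V_h \<T>"
    using n V_h_linear_image[OF bounded_linear_minus[OF bounded_linear_ident] assms]
    by (intro V_h_add) auto
  then have "(\<lambda>x. n x - n0 x) \<in> V_h0 \<T> \<Gamma>" using n by (simp add: V_h0_def)
  then show "n \<in> translate (V_h0 \<T> \<Gamma>) n0" unfolding translate_def by force
qed (use assms in \<open>auto simp: translate_def V_h0_def V_h_add\<close>)

lemma W_h_quad_iff:
  "w \<in> W_h \<T> \<longleftrightarrow> continuous_on (\<Union>\<T>) w \<and> (\<forall>x. x \<notin> \<Union>\<T> \<longrightarrow> w x = 0) \<and>
     (\<forall>T\<in>\<T>. \<exists>\<theta>. \<forall>x\<in>T. w x = quad \<theta> x)"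
  unfolding W_h_def ex_quad_iff by (rule mem_Collect_eq)

lemma W_h_quadE:
  assumes "w \<in> W_h \<T>" "T \<in> \<T>"
  obtains \<theta> where "\<And>x. x \<in> T \<Longrightarrow> w x = quad \<theta> x"
  using assms unfolding W_h_quad_iff by blast

section \<open>Convergence of finite element functions\<close>

definition cells :: "(real^2) set" where "cells = (\<Union>T\<in>\<T>. interior T)"

lemma open_cells: "open cells"
  by (auto simp: cells_def)

lemma cells_subset: "cells \<subseteq> \<Omega>"
proof -
  have "cells \<subseteq> closure \<Omega>" using interior_subset by (auto simp: cells_def simp flip: Union_mesh)
  then show ?thesis using interior_maximal[OF _ open_cells] interior_closure by metis
qed

lemma bounded_domain: "bounded \<Omega>"
proof -
  have "compact (\<Union>\<T>)" using finite_mesh compact_triangle by (rule compact_Union)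
  then show ?thesis unfolding Union_mesh by (rule bounded_subset[OF compact_imp_bounded closure_subset])
qed

lemma negligible_edges: "negligible (\<Omega> - cells)"
proof (rule negligible_subset)
  show "negligible (\<Union>T\<in>\<T>. frontier T)"
    using finite_mesh convex_triangle by (intro negligible_Union) (auto intro: negligible_convex_frontier)
  show "\<Omega> - cells \<subseteq> (\<Union>T\<in>\<T>. frontier T)"
  proof
    fix x assume x: "x \<in> \<Omega> - cells"
    then obtain T where T: "T \<in> \<T>" "x \<in> T" using closure_subset Union_mesh by blast
    then show "x \<in> (\<Union>T\<in>\<T>. frontier T)"
      using x closure_subset by (force simp: cells_def frontier_def)
  qed
qed

lemma grad_quad:
  assumes w: "\<And>x. x \<in> T \<Longrightarrow> w x = quad \<theta> x" and x: "x \<in> interior T"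
  shows "(w has_derivative quad_deriv \<theta> x) (at x)" "grad w x = matrix (quad_deriv \<theta> x)"
proof -
  show der: "(w has_derivative quad_deriv \<theta> x) (at x)"
    using has_derivative_quad open_interior x
    by (rule has_derivative_transform_within_open) (use w interior_subset in force)
  show "grad w x = matrix (quad_deriv \<theta> x)"
    using frechet_derivative_at[OF der] by (simp add: jacobian_def)
qed

text \<open>Inside a triangle the function coincides near the point with a polynomial, so the Jacobian matrix
there is a genuine derivative.\<close>

lemma grad_works:
  assumes "w \<in> W_h \<T>" "x \<in> cells"
  shows "(w has_derivative (\<lambda>h. grad w x *v h)) (at x)"
proof -
  obtain T where T: "T \<in> \<T>" "x \<in> interior T" using assms(2) by (auto simp: cells_def)
  obtain \<theta> where "\<And>x. x \<in> T \<Longrightarrow> w x = quad \<theta> x" using W_h_quadE[OF assms(1) T(1)] by blast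
  then have "w differentiable at x" using grad_quad(1) T(2) differentiableI by metis
  then show ?thesis by (simp add: jacobian_works)
qed

lemma grad_scaleR:
  assumes "w \<in> W_h \<T>" "x \<in> cells"
  shows "grad (\<lambda>x. s *\<^sub>R w x) x = s *\<^sub>R grad w x"
proof -
  have "((\<lambda>x. s *\<^sub>R w x) has_derivative (\<lambda>h. (s *\<^sub>R grad w x) *v h)) (at x)"
    using has_derivative_scaleR_right[OF grad_works[OF assms], of s]
    by (simp add: scaleR_matrix_vector_assoc)
  from frechet_derivative_at[OF this] show ?thesis by (metis jacobian_def matrix_of_matrix_vector_mul)
qed

lemma continuous_on_grad:
  assumes "w \<in> W_h \<T>"
  shows "continuous_on cells (grad w)"
  unfolding cells_def
proof (rule continuous_on_open_UN)
  fix T assume T: "T \<in> \<T>"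
  obtain \<theta> where \<theta>: "\<And>x. x \<in> T \<Longrightarrow> w x = quad \<theta> x" using W_h_quadE[OF assms T] by blast
  have "continuous_on (interior T) (\<lambda>x. matrix (quad_deriv \<theta> x))"
    by (intro continuous_on_matrix_quad_deriv continuous_intros)
  then show "continuous_on (interior T) (grad w)"
    by (rule continuous_on_eq) (simp add: grad_quad(2)[OF \<theta>])
qed auto

text \<open>The bounds are part of the notion so that dominated convergence applies to every integral of the
problem. Gradients are only compared in the open triangles, where finite element functions are
differentiable.\<close>

definition fe_converges :: "(nat \<Rightarrow> real^2 \<Rightarrow> real^2) \<Rightarrow> (real^2 \<Rightarrow> real^2) \<Rightarrow> bool" where
  "fe_converges U u \<longleftrightarrow> (\<forall>k. U k \<in> W_h \<T>) \<and> u \<in> W_h \<T> \<and>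
     (\<forall>x. (\<lambda>k. U k x) \<longlonglongrightarrow> u x) \<and> (\<exists>M. \<forall>k x. norm (U k x) \<le> M) \<and>
     (\<forall>x\<in>cells. (\<lambda>k. grad (U k) x) \<longlonglongrightarrow> grad u x) \<and> (\<exists>M. \<forall>k. \<forall>x\<in>cells. norm (grad (U k) x) \<le> M)"

lemma fe_convergesD:
  assumes "fe_converges U u"
  shows "U k \<in> W_h \<T>" "u \<in> W_h \<T>" "(\<lambda>k. U k x) \<longlonglongrightarrow> u x"
    "x \<in> cells \<Longrightarrow> (\<lambda>k. grad (U k) x) \<longlonglongrightarrow> grad u x"
  using assms by (auto simp: fe_converges_def)

lemma fe_converges_bound:
  assumes "fe_converges U u"
  obtains M where "\<And>k x. norm (U k x) \<le> M"
  using assms unfolding fe_converges_def by blast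

lemma fe_converges_grad_bound:
  assumes "fe_converges U u"
  obtains M where "\<And>k x. x \<in> cells \<Longrightarrow> norm (grad (U k) x) \<le> M"
  using assms unfolding fe_converges_def by blast

lemma fe_converges_subseq:
  assumes "fe_converges U u" "strict_mono r"
  shows "fe_converges (\<lambda>k. U (r k)) u"
proof -
  have "X \<longlonglongrightarrow> L \<Longrightarrow> (\<lambda>k. X (r k)) \<longlonglongrightarrow> L" for X :: "nat \<Rightarrow> 'a::metric_space" and L
    using LIMSEQ_subseq_LIMSEQ[OF _ assms(2)] by (simp add: o_def)
  note this[of "\<lambda>k. U k x" for x] this[of "\<lambda>k. grad (U k) x" for x]
  with assms(1) show ?thesis unfolding fe_converges_def by blast
qed

text \<open>Convergence of finitely many coefficients gives convergence of the functions: quadratic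
polynomials and their gradients depend continuously on the coefficients and the point, and
bounded coefficients together with the compact triangle range over a compact set.\<close>

lemma fe_converges_coeffs:
  assumes U: "\<And>k. U k \<in> W_h \<T>"
    and quad: "\<And>k T x. T \<in> \<T> \<Longrightarrow> x \<in> T \<Longrightarrow> U k x = quad (\<theta> k T) x"
    and lim: "\<And>T. T \<in> \<T> \<Longrightarrow> (\<lambda>k. \<theta> k T) \<longlonglongrightarrow> l T"
  shows "\<exists>u. fe_converges U u \<and> (\<forall>T\<in>\<T>. \<forall>x\<in>T. u x = quad (l T) x)"
proof -
  define u where "u x = lim (\<lambda>k. U k x)" for x
  have quad_lim: "(\<lambda>k. U k x) \<longlonglongrightarrow> quad (l T) x" if T: "T \<in> \<T>" "x \<in> T" for x T
  proof -
    have "continuous_on UNIV (\<lambda>\<theta>. quad \<theta> x)" by (intro continuous_on_quad continuous_intros)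
    then show ?thesis
      using quad[OF T] continuous_on_tendsto_compose[OF _ lim[OF T(1)], of UNIV "\<lambda>\<theta>. quad \<theta> x"] by simp
  qed
  then have u: "u x = quad (l T) x" if "T \<in> \<T>" "x \<in> T" for x T
    using that by (auto simp: u_def intro: limI)
  have u0: "U k x = 0" "u x = 0" if "x \<notin> \<Union>\<T>" for x k
    using U that by (auto simp: u_def W_h_def intro!: limI)
  have "continuous_on (\<Union>T\<in>\<T>. T) u"
  proof (rule continuous_on_closed_Union[OF finite_mesh])
    fix T assume T: "T \<in> \<T>"
    show "closed T" using compact_triangle[OF T] by (rule compact_imp_closed)
    have "continuous_on T (quad (l T))" by (intro continuous_on_quad continuous_intros)
    then show "continuous_on T u" by (rule continuous_on_eq) (simp add: u[OF T])
  qed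
  then have W: "u \<in> W_h \<T>" unfolding W_h_quad_iff using u u0(2) by (simp del: split_paired_Ex) blast
  have lim_U: "(\<lambda>k. U k x) \<longlonglongrightarrow> u x" for x
    by (cases "x \<in> \<Union>\<T>") (use quad_lim u u0 in auto)
  have lim_grad: "(\<lambda>k. grad (U k) x) \<longlonglongrightarrow> grad u x" if x: "x \<in> cells" for x
  proof -
    obtain T where T: "T \<in> \<T>" "x \<in> interior T" using x by (auto simp: cells_def)
    have "continuous_on UNIV (\<lambda>\<theta>. matrix (quad_deriv \<theta> x))"
      by (intro continuous_on_matrix_quad_deriv continuous_intros)
    from continuous_on_tendsto_compose[OF this lim[OF T(1)]]
    have "(\<lambda>k. matrix (quad_deriv (\<theta> k T) x)) \<longlonglongrightarrow> matrix (quad_deriv (l T) x)" by simp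
    then show ?thesis
      using grad_quad(2)[OF u[OF T(1)] T(2)] grad_quad(2)[OF quad[OF T(1)] T(2)] by simp
  qed
  have "\<forall>T\<in>\<T>. \<exists>R. \<forall>k. \<theta> k T \<in> cball 0 R"
    using lim convergent_imp_bounded by (fastforce simp: bounded_iff)
  then obtain R where R: "\<And>T k. T \<in> \<T> \<Longrightarrow> \<theta> k T \<in> cball 0 (R T)" by metis
  have bound: "\<exists>M. \<forall>T\<in>\<T>. \<forall>k. \<forall>x\<in>T. norm (\<Phi> (\<theta> k T) x) \<le> M"
    if "continuous_on UNIV (\<lambda>p. \<Phi> (fst p) (snd p))"
    for \<Phi> :: "coeffs \<Rightarrow> real^2 \<Rightarrow> 'c::real_normed_vector"
  proof -
    have "compact ((\<lambda>p. \<Phi> (fst p) (snd p)) ` (cball 0 (R T) \<times> T))" if "T \<in> \<T>" for T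
      using compact_triangle[OF that]
      by (intro compact_continuous_image continuous_on_subset[OF \<open>continuous_on UNIV _\<close>] compact_Times) auto
    then have "bounded (\<Union>T\<in>\<T>. (\<lambda>p. \<Phi> (fst p) (snd p)) ` (cball 0 (R T) \<times> T))" (is "bounded ?A")
      using finite_mesh by (auto intro: compact_imp_bounded)
    then obtain M where M: "\<forall>y\<in>?A. norm y \<le> M" unfolding bounded_iff by (elim exE)
    have "norm (\<Phi> (\<theta> k T) x) \<le> M" if "T \<in> \<T>" "x \<in> T" for T k x
      using R[OF that(1), of k] that by (intro M[rule_format] UN_I[of T] image_eqI[of _ _ "(\<theta> k T, x)"]) auto
    then show ?thesis by blast
  qed
  have fst_snd: "continuous_on UNIV fst" "continuous_on UNIV snd"
    by (intro continuous_intros)+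
  obtain M where M: "\<And>T k x. T \<in> \<T> \<Longrightarrow> x \<in> T \<Longrightarrow> norm (quad (\<theta> k T) x) \<le> M"
    using bound[of quad, OF continuous_on_quad[OF fst_snd]] by blast
  have bound_U: "norm (U k x) \<le> max M 0" for k x
    by (cases "x \<in> \<Union>\<T>") (use M quad u0 in \<open>auto simp: le_max_iff_disj\<close>)
  obtain M' where M': "\<And>T k x. T \<in> \<T> \<Longrightarrow> x \<in> T \<Longrightarrow> norm (matrix (quad_deriv (\<theta> k T) x)) \<le> M'"
    using bound[of "\<lambda>\<theta> x. matrix (quad_deriv \<theta> x)", OF continuous_on_matrix_quad_deriv[OF fst_snd]]
    by blast
  have bound_grad: "norm (grad (U k) x) \<le> M'" if "x \<in> cells" for k x
  proof -
    obtain T where T: "T \<in> \<T>" "x \<in> interior T" using \<open>x \<in> cells\<close> by (auto simp: cells_def)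
    then show ?thesis using grad_quad(2)[OF quad[OF T(1)] T(2)] M'[OF T(1)] interior_subset by force
  qed
  have "fe_converges U u"
    unfolding fe_converges_def using U W lim_U lim_grad bound_U bound_grad by blast
  then show ?thesis using u by blast
qed

text \<open>The size of a function is measured by the sum of the norms of its coefficient vectors. If the sizes
are unbounded, dividing by them along a subsequence gives coefficients of total norm one, and so
does their limit, which therefore is the coefficient family of a nonzero function.\<close>

lemma fe_compactness_alternative [consumes 1, case_names convergent escaping]:
  fixes U :: "nat \<Rightarrow> real^2 \<Rightarrow> real^2"
  assumes U': "\<forall>k. U k \<in> W_h \<T>"
  obtains (convergent) r u where "strict_mono r" "fe_converges (\<lambda>k. U (r k)) u"
  | (escaping) r s w where "strict_mono r" "\<And>k. s k > (0::real)" "s \<longlonglongrightarrow> 0"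
      "fe_converges (\<lambda>k x. s k *\<^sub>R U (r k) x) w" "\<exists>x. w x \<noteq> 0"
proof -
  have U: "U k \<in> W_h \<T>" for k using U' by blast
  have "\<forall>k. \<forall>T\<in>\<T>. \<exists>\<theta>. \<forall>x\<in>T. U k x = quad \<theta> x" 
    using U unfolding W_h_quad_iff by blast
  then obtain \<theta> where quad: "\<And>k T x. T \<in> \<T> \<Longrightarrow> x \<in> T \<Longrightarrow> U k x = quad (\<theta> k T) x" by metis
  define m where "m k = (\<Sum>T\<in>\<T>. norm (\<theta> k T))" for k
  have m: "norm (\<theta> k T) \<le> m k" if "T \<in> \<T>" for k T
    unfolding m_def using that finite_mesh by (intro member_le_sum) auto
  show thesis
  proof (cases "\<exists>R. \<forall>k. m k \<le> R")
    case True
    then obtain R where "\<And>k. m k \<le> R" by blast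
    then have "norm (\<theta> k T) \<le> R" if "T \<in> \<T>" for k T
      using m[OF that] order_trans by blast
    then have "\<forall>T\<in>\<T>. bounded (range (\<lambda>k. \<theta> k T))"
      unfolding bounded_iff by blast
    then obtain r l where "strict_mono r" and r: "\<forall>T\<in>\<T>. (\<lambda>k. \<theta> (r k) T) \<longlonglongrightarrow> l T"
      using finite_family_convergent_subsequence[of \<T> \<theta>, OF finite_mesh] by blast
    from fe_converges_coeffs[of "\<lambda>k. U (r k)" "\<lambda>k. \<theta> (r k)", OF U quad r[rule_format]]
    show thesis using convergent \<open>strict_mono r\<close> by blast
  next
    case False
    have *: "\<exists>k>N. m k > c" for c N
    proof (rule ccontr)
      assume "\<not> ?thesis"
      then have "m k \<le> max c (Max (m ` {..N}))" for k
        by (cases "k > N") (auto simp: le_max_iff_disj not_less intro!: Max_ge)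
      then show False using False by blast
    qed
    \<comment> \<open>The sizes exceed \<open>k + 1\<close> along \<open>q\<close>, so their inverses \<open>s\<close> tend to zero.\<close>
    obtain q where q: "\<And>k. m (q k) > real (Suc k)" "\<And>k. q k < q (Suc k)"
      using dependent_nat_choice[of "\<lambda>k i. m i > real (Suc k)" "\<lambda>k i j. i < j"] * by metis
    then have "strict_mono q" by (simp add: strict_mono_Suc_iff)
    define s where "s k = inverse (m (q k))" for k
    have pos: "m (q k) > 0" for k using q(1)[of k] by linarith
    have s_pos: "s k > 0" for k using pos by (simp add: s_def)
    have s_lim: "s \<longlonglongrightarrow> 0"
    proof (rule tendsto_sandwich[OF _ _ tendsto_const LIMSEQ_inverse_real_of_nat])
      show "\<forall>\<^sub>F k in sequentially. 0 \<le> s k" using s_pos by (simp add: less_imp_le)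
      show "\<forall>\<^sub>F k in sequentially. s k \<le> inverse (real (Suc k))"
        using q(1) by (intro always_eventually allI) (auto simp: s_def less_imp_le intro!: le_imp_inverse_le)
    qed
    have s_norm: "norm (s k *\<^sub>R \<theta> (q k) T) \<le> 1" if "T \<in> \<T>" for k T
      using m[OF that, of "q k"] pos[of k] by (simp add: s_def field_simps)
    then have "\<forall>T\<in>\<T>. bounded (range (\<lambda>k. s k *\<^sub>R \<theta> (q k) T))"
      unfolding bounded_iff by blast
    then obtain p l where p: "strict_mono p"
      and l: "\<And>T. T \<in> \<T> \<Longrightarrow> (\<lambda>k. s (p k) *\<^sub>R \<theta> (q (p k)) T) \<longlonglongrightarrow> l T"
      using finite_family_convergent_subsequence[of \<T> "\<lambda>k T. s k *\<^sub>R \<theta> (q k) T", OF finite_mesh] by blast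
    have sW: "(\<lambda>x. s (p k) *\<^sub>R U (q (p k)) x) \<in> W_h \<T>" for k
    proof -
      have "\<exists>\<theta>'. \<forall>x\<in>T. s (p k) *\<^sub>R U (q (p k)) x = quad \<theta>' x" if "T \<in> \<T>" for T
        using quad[OF that] by (intro exI[of _ "s (p k) *\<^sub>R \<theta> (q (p k)) T"]) (simp add: quad_scaleR)
      then show ?thesis
        using U[of "q (p k)"] unfolding W_h_quad_iff
        by (intro conjI allI impI ballI continuous_on_scaleR continuous_on_const) auto
    qed
    obtain w where w: "fe_converges (\<lambda>k x. s (p k) *\<^sub>R U (q (p k)) x) w"
      and w_quad: "\<forall>T\<in>\<T>. \<forall>x\<in>T. w x = quad (l T) x"
      using fe_converges_coeffs[of "\<lambda>k x. s (p k) *\<^sub>R U (q (p k)) x"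
          "\<lambda>k T. s (p k) *\<^sub>R \<theta> (q (p k)) T", OF sW _ l] quad by (auto simp: quad_scaleR)
    have "(\<Sum>T\<in>\<T>. norm (s k *\<^sub>R \<theta> (q k) T)) = 1" for k
      using pos[of k] by (simp add: s_def m_def flip: sum_distrib_left)
    moreover have "(\<lambda>k. \<Sum>T\<in>\<T>. norm (s (p k) *\<^sub>R \<theta> (q (p k)) T)) \<longlonglongrightarrow> (\<Sum>T\<in>\<T>. norm (l T))"
      using l by (intro tendsto_sum tendsto_norm)
    ultimately have "(\<Sum>T\<in>\<T>. norm (l T)) \<noteq> 0" by (simp add: LIMSEQ_const_iff)
    then obtain T where T: "T \<in> \<T>" "l T \<noteq> 0" by (auto elim: sum.not_neutral_contains_not_neutral)
    then have "\<exists>x. w x \<noteq> 0"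
      using quad_eq_0_imp[OF interior_triangle_nonempty] w_quad by metis
    moreover have "(\<lambda>k. s (p k)) \<longlonglongrightarrow> 0" using LIMSEQ_subseq_LIMSEQ[OF s_lim p] by (simp add: o_def)
    ultimately show thesis
      by (intro escaping[of "\<lambda>k. q (p k)" "\<lambda>k. s (p k)" w] s_pos w
          strict_mono_o[OF \<open>strict_mono q\<close> p, unfolded o_def])
  qed
qed

end

section \<open>The direct method\<close>

text \<open>Boundedness from below comes out of the same compactness: a sequence with energies below \<open>-k\<close>
would have a subsequence whose energies converge to a real number.\<close>

lemma ex_minimizer_of_compact_sublevels:
  fixes E :: "'a \<Rightarrow> real"
  assumes "A \<noteq> {}"
    and compact: "\<And>X C. \<lbrakk>\<And>k::nat. X k \<in> A; \<And>k. E (X k) \<le> C\<rbrakk> \<Longrightarrow>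
      \<exists>r x. strict_mono r \<and> x \<in> A \<and> (\<lambda>k. E (X (r k))) \<longlonglongrightarrow> E x"
  shows "\<exists>x\<in>A. \<forall>y\<in>A. E x \<le> E y"
proof -
  have below: "bdd_below (E ` A)"
  proof (rule ccontr)
    assume "\<not> ?thesis"
    then have "\<forall>k. \<exists>x\<in>A. E x < - real k" by (force simp: bdd_below_def not_le)
    then obtain X where X: "\<And>k. X k \<in> A" "\<And>k. E (X k) < - real k" by metis
    have "E (X k) \<le> 0" for k using X(2)[of k] by linarith
    then obtain r x where r: "strict_mono r" and lim: "(\<lambda>k. E (X (r k))) \<longlonglongrightarrow> E x"
      using compact[of X 0] X(1) by blast
    have "bdd_below (range (\<lambda>k. E (X (r k))))"
      using convergent_imp_bounded[OF lim] by (rule bounded_imp_bdd_below)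
    then obtain m where m: "\<And>k. m \<le> E (X (r k))" by (auto simp: bdd_below_def)
    obtain k where "- m < real k" using reals_Archimedean2 by blast
    moreover have "real k \<le> real (r k)" using seq_suble[OF r] by simp
    ultimately show False using m[of k] X(2)[of "r k"] by linarith
  qed
  have "\<exists>x\<in>A. E x < Inf (E ` A) + inverse (real (Suc k))" for k
    using cInf_lessD[of "E ` A" "Inf (E ` A) + inverse (real (Suc k))"] \<open>A \<noteq> {}\<close> by auto
  then obtain X where X: "\<And>k. X k \<in> A" "\<And>k. E (X k) < Inf (E ` A) + inverse (real (Suc k))"
    by (metis (no_types))
  have "inverse (real (Suc k)) \<le> 1" for k by (simp add: field_simps)
  then have "E (X k) \<le> Inf (E ` A) + 1" for k
    using X(2)[of k] by (meson add_left_mono less_imp_le order_trans)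
  then obtain r x where r: "strict_mono r" and x: "x \<in> A" and lim: "(\<lambda>k. E (X (r k))) \<longlonglongrightarrow> E x"
    using compact[of X] X(1) by blast
  have "(\<lambda>k. Inf (E ` A) + inverse (real (Suc (r k)))) \<longlonglongrightarrow> Inf (E ` A) + 0"
    using LIMSEQ_subseq_LIMSEQ[OF LIMSEQ_inverse_real_of_nat r]
    by (intro tendsto_add tendsto_const) (simp add: o_def)
  then have "E x \<le> Inf (E ` A) + 0"
    using lim X(2) by (intro LIMSEQ_le) (auto intro: less_imp_le)
  moreover have "Inf (E ` A) \<le> E y" if "y \<in> A" for y
    using below that by (intro cInf_lower) auto
  ultimately show ?thesis using x by (intro bexI[of _ x] ballI) force+
qed

section \<open>Passing to the limit in integrals\<close>

text \<open>The function vanishes almost everywhere, and the set where it does not is open; a nonempty open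
set is not negligible.\<close>

lemma continuous_nonneg_integral_eq_0:
  fixes \<phi> :: "'a::euclidean_space \<Rightarrow> real"
  assumes S: "open S" "bounded S" and cont: "continuous_on S \<phi>"
    and bounds: "\<And>x. x \<in> S \<Longrightarrow> 0 \<le> \<phi> x" "\<And>x. x \<in> S \<Longrightarrow> \<phi> x \<le> B"
    and int: "(LINT x:S|lebesgue. \<phi> x) \<le> 0" and x: "x \<in> S"
  shows "\<phi> x = 0"
proof -
  let ?\<psi> = "\<lambda>x. indicator S x *\<^sub>R \<phi> x"
  have meas: "?\<psi> \<in> borel_measurable lebesgue"
    using borel_measurable_continuous_on_indicator[OF _ cont] S(1) by (simp add: measurable_completion)
  have "S \<in> lmeasurable" using S by (simp add: lmeasurable_open)
  then have "integrable lebesgue (\<lambda>x. indicator S x * B)"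
    by (simp add: lmeasurable_iff_integrable)
  moreover have "norm (?\<psi> x) \<le> norm (indicator S x * B)" for x
    using bounds[of x] by (cases "x \<in> S") auto
  ultimately have int': "integrable lebesgue ?\<psi>"
    by (intro Bochner_Integration.integrable_bound[OF _ meas, of "\<lambda>x. indicator S x * B"]) auto
  moreover have nonneg: "AE x in lebesgue. 0 \<le> ?\<psi> x"
    using bounds(1) by (auto simp: indicator_def)
  ultimately have "AE x in lebesgue. ?\<psi> x = 0"
    using int integral_nonneg_eq_0_iff_AE[OF int' nonneg] integral_nonneg_AE[OF nonneg]
    unfolding set_lebesgue_integral_def by linarith
  then have "negligible {x. ?\<psi> x \<noteq> 0}"
    by (simp add: completion.AE_iff_null_sets negligible_iff_null_sets)
  moreover have "{x. ?\<psi> x \<noteq> 0} = S \<inter> \<phi> -` (- {0})" by (auto simp: indicator_def)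
  moreover have "open (S \<inter> \<phi> -` (- {0}))"
    using continuous_on_open_vimage[OF S(1)] cont by (metis Int_commute closed_singleton open_Compl)
  ultimately have "S \<inter> \<phi> -` (- {0}) = {}" using open_not_negligible by metis
  then show ?thesis using x by auto
qed

text \<open>Used for the body force with Lebesgue measure on the domain and for the traction with arc length on
the boundary edges: the weight is only integrable, so uniform bounds on the displacements provide
the dominating function.\<close>

lemma weighted_integral_tendsto:
  fixes h u :: "'a::topological_space \<Rightarrow> 'b::euclidean_space" and \<mu> :: "'a measure"
  assumes \<mu>: "sets borel \<subseteq> sets \<mu>" "space \<mu> = UNIV" and h: "set_integrable \<mu> A h"
    and meas: "\<And>k. U k \<in> borel_measurable borel" "u \<in> borel_measurable borel"
    and lim: "\<And>x. (\<lambda>k. U k x) \<longlonglongrightarrow> u x" and bound: "\<And>k x. norm (U k x) \<le> M"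
  shows "(\<lambda>k. LINT x:A|\<mu>. h x \<bullet> U k x) \<longlonglongrightarrow> (LINT x:A|\<mu>. h x \<bullet> u x)"
proof -
  have eq: "indicator A x *\<^sub>R (h x \<bullet> v) = (indicator A x *\<^sub>R h x) \<bullet> v" for x v by simp
  have h': "integrable \<mu> (\<lambda>x. indicator A x *\<^sub>R h x)" using h by (simp add: set_integrable_def)
  have [measurable]: "(\<lambda>x. indicator A x *\<^sub>R h x) \<in> borel_measurable \<mu>"
    using h' by (rule borel_measurable_integrable)
  have mono: "v \<in> borel_measurable borel \<Longrightarrow> v \<in> borel_measurable \<mu>" for v :: "'a \<Rightarrow> 'b"
    using measurable_mono[of borel borel borel \<mu>] \<mu> by auto
  have [measurable]: "U k \<in> borel_measurable \<mu>" "u \<in> borel_measurable \<mu>" for k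
    using meas by (auto intro: mono)
  have "(\<lambda>k. LINT x|\<mu>. (indicator A x *\<^sub>R h x) \<bullet> U k x) \<longlonglongrightarrow> (LINT x|\<mu>. (indicator A x *\<^sub>R h x) \<bullet> u x)"
  proof (rule integral_dominated_convergence[where w = "\<lambda>x. norm (indicator A x *\<^sub>R h x) * M"])
    show "integrable \<mu> (\<lambda>x. norm (indicator A x *\<^sub>R h x) * M)"
      by (intro integrable_mult_left integrable_norm h')
    show "AE x in \<mu>. (\<lambda>k. (indicator A x *\<^sub>R h x) \<bullet> U k x) \<longlonglongrightarrow> (indicator A x *\<^sub>R h x) \<bullet> u x"
      by (intro AE_I2 tendsto_intros lim)
    show "AE x in \<mu>. norm ((indicator A x *\<^sub>R h x) \<bullet> U k x) \<le> norm (indicator A x *\<^sub>R h x) * M" for k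
    proof (rule AE_I2)
      fix x
      have "norm ((indicator A x *\<^sub>R h x) \<bullet> U k x) \<le> norm (indicator A x *\<^sub>R h x) * norm (U k x)"
        unfolding real_norm_def by (rule Cauchy_Schwarz_ineq2)
      also have "\<dots> \<le> norm (indicator A x *\<^sub>R h x) * M" by (intro mult_left_mono bound norm_ge_zero)
      finally show "norm ((indicator A x *\<^sub>R h x) \<bullet> U k x) \<le> norm (indicator A x *\<^sub>R h x) * M" .
    qed
  qed measurable
  then show ?thesis unfolding set_lebesgue_integral_def eq .
qed

lemma arclength_measure:
  "sets borel \<subseteq> sets (arclength e)" "space (arclength e) = UNIV"
  by (auto simp: arclength_def split_beta Let_def intro: sets_completionI_sets)

context planar_mesh
begin

lemma W_h_measurable:
  assumes "w \<in> W_h \<T>"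
  shows "w \<in> borel_measurable borel"
proof -
  have "(\<lambda>x. indicator (closure \<Omega>) x *\<^sub>R w x) \<in> borel_measurable borel"
    using assms by (intro borel_measurable_continuous_on_indicator) (auto simp: W_h_def Union_mesh)
  also have "(\<lambda>x. indicator (closure \<Omega>) x *\<^sub>R w x) = w"
    using assms by (auto simp: W_h_def Union_mesh indicator_def fun_eq_iff)
  finally show ?thesis .
qed

lemma AE_cells: "AE x in lebesgue. x \<in> cells \<longleftrightarrow> x \<in> \<Omega>"
proof -
  have "AE x in lebesgue. x \<notin> \<Omega> - cells"
    using negligible_edges by (intro AE_not_in) (simp add: negligible_iff_null_sets)
  then show ?thesis by eventually_elim (use cells_subset in auto)
qed

text \<open>Functions of gradients are continuous in the open triangles and arbitrary on the edges. Measurability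
on the domain follows because the edges are null and Lebesgue measure is complete.\<close>

lemma cellwise_continuous_measurable:
  fixes \<psi> :: "real^2 \<Rightarrow> real"
  assumes "continuous_on cells \<psi>"
  shows "(\<lambda>x. indicator \<Omega> x *\<^sub>R \<psi> x) \<in> borel_measurable lebesgue"
    and "(LINT x:\<Omega>|lebesgue. \<psi> x) = (LINT x:cells|lebesgue. \<psi> x)"
proof -
  have meas: "(\<lambda>x. indicator cells x *\<^sub>R \<psi> x) \<in> borel_measurable lebesgue"
    using borel_measurable_continuous_on_indicator[OF _ assms] open_cells
    by (simp add: measurable_completion)
  have ae: "AE x in lebesgue. indicator cells x *\<^sub>R \<psi> x = indicator \<Omega> x *\<^sub>R \<psi> x"
    using AE_cells by eventually_elim (auto simp: indicator_def)
  from borel_measurable_AE[OF meas ae]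
  show meas': "(\<lambda>x. indicator \<Omega> x *\<^sub>R \<psi> x) \<in> borel_measurable lebesgue" .
  show "(LINT x:\<Omega>|lebesgue. \<psi> x) = (LINT x:cells|lebesgue. \<psi> x)"
    unfolding set_lebesgue_integral_def
    using ae by (intro integral_cong_AE meas meas') (auto elim: eventually_mono)
qed

lemma cellwise_integral_cong:
  fixes \<phi> \<psi> :: "real^2 \<Rightarrow> real"
  assumes "continuous_on cells \<phi>" "\<And>x. x \<in> cells \<Longrightarrow> \<phi> x = \<psi> x"
  shows "(LINT x:\<Omega>|lebesgue. \<phi> x) = (LINT x:\<Omega>|lebesgue. \<psi> x)"
proof -
  have "continuous_on cells \<psi>" using assms by (rule continuous_on_eq)
  then have "(LINT x:\<Omega>|lebesgue. \<psi> x) = (LINT x:cells|lebesgue. \<psi> x)"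
    by (rule cellwise_continuous_measurable)
  also have "\<dots> = (LINT x:cells|lebesgue. \<phi> x)"
    unfolding set_lebesgue_integral_def using assms(2)
    by (intro Bochner_Integration.integral_cong) (auto simp: indicator_def)
  also have "\<dots> = (LINT x:\<Omega>|lebesgue. \<phi> x)"
    using cellwise_continuous_measurable(2)[OF assms(1)] by simp
  finally show ?thesis by simp
qed

text \<open>The integrand is a continuous function \<open>\<Phi>\<close> of quantities \<open>h\<^sub>k\<close> that converge and are uniformly bounded in the
open triangles; \<open>\<Phi>\<close> is bounded on the ball in which they lie, and the domain has finite measure.\<close>

lemma cellwise_bounded_convergence:
  fixes h :: "nat \<Rightarrow> real^2 \<Rightarrow> 'c::euclidean_space" and \<Phi> :: "'c \<Rightarrow> real"
  assumes cont: "\<And>k. continuous_on cells (h k)" "continuous_on cells l"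
    and lim: "\<And>x. x \<in> cells \<Longrightarrow> (\<lambda>k. h k x) \<longlonglongrightarrow> l x"
    and bound: "\<And>k x. x \<in> cells \<Longrightarrow> norm (h k x) \<le> M"
    and \<Phi>: "continuous_on UNIV \<Phi>"
  shows "(\<lambda>k. LINT x:\<Omega>|lebesgue. \<Phi> (h k x)) \<longlonglongrightarrow> (LINT x:\<Omega>|lebesgue. \<Phi> (l x))"
proof -
  have "bounded (\<Phi> ` cball 0 M)"
    by (intro compact_imp_bounded compact_continuous_image continuous_on_subset[OF \<Phi>]) auto
  then obtain B where B: "\<forall>y\<in>\<Phi> ` cball 0 M. norm y \<le> B"
    unfolding bounded_iff by (elim exE)
  have \<Phi>_cont: "continuous_on cells (\<lambda>x. \<Phi> (f x))" if "continuous_on cells f" for f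
    by (rule continuous_on_compose2[OF \<Phi> that]) auto
  show ?thesis
    unfolding set_lebesgue_integral_def
  proof (rule integral_dominated_convergence[where w = "\<lambda>x. indicator \<Omega> x * B"])
    show "(\<lambda>x. indicator \<Omega> x *\<^sub>R \<Phi> (l x)) \<in> borel_measurable lebesgue"
      by (intro cellwise_continuous_measurable \<Phi>_cont cont)
    show "(\<lambda>x. indicator \<Omega> x *\<^sub>R \<Phi> (h k x)) \<in> borel_measurable lebesgue" for k
      by (intro cellwise_continuous_measurable \<Phi>_cont cont)
    have "\<Omega> \<in> lmeasurable" using open_domain bounded_domain by (simp add: lmeasurable_open)
    then show "integrable lebesgue (\<lambda>x. indicator \<Omega> x * B)"
      by (simp add: lmeasurable_iff_integrable)
    show "AE x in lebesgue. (\<lambda>k. indicator \<Omega> x *\<^sub>R \<Phi> (h k x)) \<longlonglongrightarrow> indicator \<Omega> x *\<^sub>R \<Phi> (l x)"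
      using AE_cells
    proof eventually_elim
      case (elim x)
      show ?case
      proof (cases "x \<in> cells")
        case True
        show ?thesis
          by (intro tendsto_scaleR tendsto_const continuous_on_tendsto_compose[OF \<Phi> lim[OF True]]) auto
      qed (use elim in auto)
    qed
    show "AE x in lebesgue. norm (indicator \<Omega> x *\<^sub>R \<Phi> (h k x)) \<le> indicator \<Omega> x * B" for k
      using AE_cells
    proof eventually_elim
      case (elim x)
      show ?case
      proof (cases "x \<in> cells")
        case True
        then have "h k x \<in> cball 0 M" using bound by simp
        then have "norm (\<Phi> (h k x)) \<le> B" using B by blast
        then show ?thesis by (simp add: indicator_def)
      qed (use elim in auto)
    qed
  qed
qed

lemma boundary_integral_tendsto:
  assumes g: "boundary_integrable \<Omega> \<T> \<Gamma> g" and U: "fe_converges U u"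
  shows "(\<lambda>k. boundary_integral \<Omega> \<T> \<Gamma> (\<lambda>x. g x \<bullet> U k x)) \<longlonglongrightarrow>
    boundary_integral \<Omega> \<T> \<Gamma> (\<lambda>x. g x \<bullet> u x)"
  unfolding boundary_integral_def
proof (rule tendsto_sum)
  fix e assume "e \<in> boundary_edges \<Omega> \<T>"
  then have "set_integrable (arclength e) \<Gamma> g" using g by (simp add: boundary_integrable_def)
  moreover obtain M where "\<And>k x. norm (U k x) \<le> M" using fe_converges_bound[OF U] by blast
  ultimately show "(\<lambda>k. LINT x:\<Gamma>|arclength e. g x \<bullet> U k x) \<longlonglongrightarrow> (LINT x:\<Gamma>|arclength e. g x \<bullet> u x)"
    by (intro weighted_integral_tendsto[OF arclength_measure] W_h_measurable fe_convergesD[OF U])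
qed

lemma body_integral_tendsto:
  assumes f: "set_integrable lebesgue \<Omega> f" and U: "fe_converges U u"
  shows "(\<lambda>k. LINT x:\<Omega>|lebesgue. f x \<bullet> U k x) \<longlonglongrightarrow> (LINT x:\<Omega>|lebesgue. f x \<bullet> u x)"
proof -
  have leb: "sets borel \<subseteq> sets (lebesgue :: (real^2) measure)" "space (lebesgue :: (real^2) measure) = UNIV"
    by (auto intro: sets_completionI_sets)
  obtain M where "\<And>k x. norm (U k x) \<le> M" using fe_converges_bound[OF U] by blast
  then show ?thesis
    by (intro weighted_integral_tendsto[OF leb f] W_h_measurable fe_convergesD[OF U])
qed

end

section \<open>The energy density\<close>

text \<open>The Cauchy--Schwarz inequality applied to the rows of the matrix: the Euclidean operator norm is
at most the Frobenius norm.\<close>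

lemma norm_transpose_mult_le:
  fixes A :: "real^'n^'m"
  shows "norm (transpose A *v v) \<le> norm A * norm v"
proof -
  have "transpose A *v v = (\<Sum>j\<in>UNIV. v $ j *\<^sub>R A $ j)"
    by (simp add: vec_eq_iff matrix_vector_mult_def transpose_def mult.commute)
  also have "norm \<dots> \<le> (\<Sum>j\<in>UNIV. \<bar>norm (A $ j)\<bar> * \<bar>v $ j\<bar>)"
    by (rule order_trans[OF norm_sum]) (simp add: mult.commute)
  also have "\<dots> \<le> norm A * norm v"
    unfolding norm_vec_def[of A] norm_vec_def[of v] using L2_set_mult_ineq[of "\<lambda>j. norm (A $ j)" "\<lambda>j. v $ j" UNIV]
    by (simp add: L2_set_def)
  finally show ?thesis .
qed

lemma continuous_on_transpose_mult:
  fixes f :: "'a::topological_space \<Rightarrow> real^'n^'m"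
  assumes "continuous_on S f" "continuous_on S g"
  shows "continuous_on S (\<lambda>x. transpose (f x) *v g x)"
  unfolding matrix_vector_mult_def transpose_def
  by (simp, intro continuous_on_vec_lambda continuous_intros assms)

lemma transpose_scaleR_mult: "transpose (s *\<^sub>R A) *v v = s *\<^sub>R (transpose A *v v)"
  for A :: "real^'n^'m"
  by (simp add: vec_eq_iff matrix_vector_mult_def transpose_def sum_distrib_left mult.assoc)

text \<open>The two gradients are arguments of their own, so that they can be rescaled independently of the
director \<open>v\<close>, in which the density is not homogeneous.\<close>

definition energy_density :: "real \<Rightarrow> real \<Rightarrow> real^2^2 \<Rightarrow> real^2 \<Rightarrow> real^2^2 \<Rightarrow> real" where
  "energy_density a b F v H =
     ((norm F)\<^sup>2 - (1 - a) * (norm (transpose F *v v))\<^sup>2) + b * (norm H)\<^sup>2"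

lemma continuous_on_energy_density:
  assumes "continuous_on S F" "continuous_on S v" "continuous_on S H"
  shows "continuous_on S (\<lambda>x. energy_density a b (F x) (v x) (H x))"
  unfolding energy_density_def
  by (intro continuous_intros continuous_on_transpose_mult assms)

lemma energy_density_scaleR:
  "energy_density a b (s *\<^sub>R F) v (s *\<^sub>R H) = s\<^sup>2 * energy_density a b F v H"
  unfolding energy_density_def transpose_scaleR_mult by (simp add: power_mult_distrib algebra_simps)

text \<open>The director reduces the elastic term by at most the fraction \<open>1 - a\<close>, which leaves \<open>a\<close>; here the
bound on the norm of the director enters.\<close>

lemma energy_density_coercive:
  assumes "a \<le> 1" "norm v \<le> 1"
  shows "a * (norm F)\<^sup>2 \<le> energy_density a b F v 0"
proof -
  have "norm (transpose F *v v) \<le> norm F * 1"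
    using norm_transpose_mult_le assms(2) by (rule order_trans[OF _ mult_left_mono]) simp
  then have "(norm (transpose F *v v))\<^sup>2 \<le> (norm F)\<^sup>2" by (simp add: power_mono)
  then have "(1 - a) * (norm (transpose F *v v))\<^sup>2 \<le> (1 - a) * (norm F)\<^sup>2"
    using assms(1) by (intro mult_left_mono) auto
  then show ?thesis by (simp add: energy_density_def algebra_simps)
qed

section \<open>Admissible directors and displacements\<close>

context planar_mesh
begin

text \<open>The limit coincides with the interpolant of its own nodal values: barycentric representations pass to
the limit.\<close>

lemma V_h_limit:
  fixes N :: "nat \<Rightarrow> real^2 \<Rightarrow> 'b::real_normed_vector"
  assumes N: "\<And>k. N k \<in> V_h \<T>" and lim: "\<And>x. (\<lambda>k. N k x) \<longlonglongrightarrow> n x"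
  shows "n \<in> V_h \<T>"
proof -
  obtain v where v: "v \<in> V_h \<T>" "\<And>z. z \<in> nodes \<T> \<Longrightarrow> v z = n z"
    using ex_nodal_interpolant[of n] by blast
  have "(\<lambda>k. N k x) \<longlonglongrightarrow> v x" for x
  proof (cases "x \<in> \<Union>\<T>")
    case True
    then obtain T where T: "T \<in> \<T>" "x \<in> T" by blast
    obtain \<alpha> where \<alpha>: "\<forall>z\<in>vertices T. 0 \<le> \<alpha> z" "sum \<alpha> (vertices T) = 1"
      "x = (\<Sum>z\<in>vertices T. \<alpha> z *\<^sub>R z)" using barycentric_coordinates[OF T] by blast
    have "(\<lambda>k. \<Sum>z\<in>vertices T. \<alpha> z *\<^sub>R N k z) \<longlonglongrightarrow> (\<Sum>z\<in>vertices T. \<alpha> z *\<^sub>R n z)"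
      by (intro tendsto_intros lim)
    also have "(\<Sum>z\<in>vertices T. \<alpha> z *\<^sub>R n z) = (\<Sum>z\<in>vertices T. \<alpha> z *\<^sub>R v z)"
      using T(1) by (intro sum.cong refl arg_cong[of _ _ "scaleR _"] v(2)[symmetric]) (auto simp: nodes_eq)
    finally show ?thesis
      unfolding \<alpha>(3) V_h_barycentric[OF N T(1) \<alpha>(1,2)] V_h_barycentric[OF v(1) T(1) \<alpha>(1,2)] .
  next
    case False
    then have "N k x = 0" "v x = 0" for k using N v(1) by (auto simp: V_h_def)
    then show ?thesis by simp
  qed
  then have "n = v" using lim LIMSEQ_unique by blast
  then show ?thesis using v(1) by simp
qed

lemma V_h_integral_square_eq_0:
  fixes p :: "real^2 \<Rightarrow> real"
  assumes p: "p \<in> V_h \<T>" and int: "(LINT x:\<Omega>|lebesgue. p x * p x) = 0" and z: "z \<in> \<Union>\<T>"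
  shows "p z = 0"
proof -
  have cont: "continuous_on (closure \<Omega>) p" using p by (simp add: V_h_def Union_mesh)
  have "compact (closure \<Omega>)" using bounded_domain by (simp add: compact_closure)
  then have "bounded ((\<lambda>x. p x * p x) ` closure \<Omega>)"
    by (intro compact_imp_bounded compact_continuous_image continuous_intros cont)
  then obtain B where "\<forall>y\<in>(\<lambda>x. p x * p x) ` closure \<Omega>. norm y \<le> B"
    unfolding bounded_iff by (elim exE)
  then have "p x * p x \<le> B" if "x \<in> \<Omega>" for x
    using that closure_subset[of \<Omega>] by fastforce
  moreover have "continuous_on \<Omega> (\<lambda>x. p x * p x)"
    by (intro continuous_intros continuous_on_subset[OF cont] closure_subset)
  ultimately have "p x * p x = 0" if "x \<in> \<Omega>" for x
    using that int by (intro continuous_nonneg_integral_eq_0[OF open_domain bounded_domain]) auto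
  then have "p x = 0" if "x \<in> \<Omega>" for x using that by simp
  then show ?thesis
    using continuous_constant_on_closure[OF cont, of 0] z by (simp add: Union_mesh)
qed

text \<open>The interpolant \<open>\<pi>\<^sub>h(|n|\<^sup>2 - 1)\<close> lies in the test space, so it may be taken as the test function;
then the integral of its square is zero.\<close>

lemma N_h_iff:
  assumes n0: "n0 \<in> V_h \<T>"
    and interp: "\<forall>n \<in> translate (V_h0 \<T> \<Gamma>) n0. nodal_interp \<T> (\<lambda>x. (norm (n x))\<^sup>2 - 1) \<in> V_h0 \<T> \<Gamma>"
  shows "n \<in> N_h \<Omega> \<T> \<Gamma> n0 \<longleftrightarrow>
    n \<in> V_h \<T> \<and> (\<forall>x\<in>\<Gamma>. n x = n0 x) \<and> (\<forall>z\<in>nodes \<T>. norm (n z) = 1)"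
proof -
  let ?p = "nodal_interp \<T> (\<lambda>x. (norm (n x))\<^sup>2 - 1)"
  have "(\<forall>\<mu> \<in> V_h0 \<T> \<Gamma>. (LINT x:\<Omega>|lebesgue. \<mu> x * ?p x) = 0) \<longleftrightarrow> (\<forall>z\<in>nodes \<T>. norm (n z) = 1)"
    if n: "n \<in> translate (V_h0 \<T> \<Gamma>) n0"
  proof
    assume "\<forall>\<mu> \<in> V_h0 \<T> \<Gamma>. (LINT x:\<Omega>|lebesgue. \<mu> x * ?p x) = 0"
    then have "(LINT x:\<Omega>|lebesgue. ?p x * ?p x) = 0" using interp n by blast
    then have p: "?p z = 0" if "z \<in> \<Union>\<T>" for z
      using that by (rule V_h_integral_square_eq_0[OF nodal_interp_in_V_h])
    show "\<forall>z\<in>nodes \<T>. norm (n z) = 1"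
    proof
      fix z assume z: "z \<in> nodes \<T>"
      then have "z \<in> \<Union>\<T>" using vertices_subset by (auto simp: nodes_eq)
      then have "(norm (n z))\<^sup>2 = 1\<^sup>2" using p nodal_interp_at_node[OF z, of "\<lambda>x. (norm (n x))\<^sup>2 - 1"] by simp
      then show "norm (n z) = 1" by (rule power2_eq_imp_eq) auto
    qed
  next
    assume "\<forall>z\<in>nodes \<T>. norm (n z) = 1"
    moreover have "(\<lambda>_. 0) \<in> V_h \<T>"
      by (auto simp: V_h_def intro!: exI[of _ 0] exI[of _ "\<lambda>_. 0"] linear_zero)
    ultimately have "?p = (\<lambda>_. 0)"
      by (intro V_h_eqI nodal_interp_in_V_h) (auto simp: nodal_interp_at_node)
    then show "\<forall>\<mu> \<in> V_h0 \<T> \<Gamma>. (LINT x:\<Omega>|lebesgue. \<mu> x * ?p x) = 0"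
      by (simp add: set_lebesgue_integral_def)
  qed
  then show ?thesis unfolding N_h_def using translate_V_h0[OF n0] by auto
qed

text \<open>Let \<open>Z\<close> be the set of nodes at which all functions vanishing on \<open>\<Gamma>\<close> vanish, that is, the nodes whose
values are prescribed by those on \<open>\<Gamma>\<close>. The admissible director is \<open>n\<^sub>0\<close> on \<open>Z\<close> and a fixed unit vector at
the other nodes.

It has norm one on \<open>Z\<close>: the interpolant of \<open>|n\<^sub>0|\<^sup>2 - 1\<close> vanishes on \<open>\<Gamma>\<close>, hence (times a constant
vector) on \<open>Z\<close>.

It agrees with \<open>n\<^sub>0\<close> on \<open>\<Gamma>\<close>: let \<open>x \<in> \<Gamma>\<close> have barycentric coordinates \<open>\<alpha>\<^sub>z\<close>, and let \<open>v\<close> vanish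
on \<open>\<Gamma>\<close>. By hypothesis \<open>\<Sum> \<alpha>\<^sub>z (|n\<^sub>0(z) + s v(z)|\<^sup>2 - 1) = 0\<close> for every real \<open>s\<close>. The second difference in \<open>s\<close>
is \<open>2 \<Sum> \<alpha>\<^sub>z |v(z)|\<^sup>2\<close>, so \<open>v\<close> vanishes at every vertex with \<open>\<alpha>\<^sub>z > 0\<close>. These vertices
therefore lie in \<open>Z\<close>, and they determine the value at \<open>x\<close>.\<close>

lemma N_h_nonempty:
  assumes n0: "n0 \<in> V_h \<T>" and \<Gamma>: "\<Gamma> \<subseteq> \<Union>\<T>"
    and interp: "\<forall>n \<in> translate (V_h0 \<T> \<Gamma>) n0. nodal_interp \<T> (\<lambda>x. (norm (n x))\<^sup>2 - 1) \<in> V_h0 \<T> \<Gamma>"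
  shows "N_h \<Omega> \<T> \<Gamma> n0 \<noteq> {}"
proof -
  \<comment> \<open>Vector-valued test functions; a scalar one is turned into a vector-valued one through \<open>?e\<close>.\<close>
  define Z where "Z = {z \<in> nodes \<T>. \<forall>v\<in>V_h0 \<T> \<Gamma>. v z = (0::real^2)}"
  let ?e = "axis 1 1 :: real^2"
  have n0': "n0 \<in> translate (V_h0 \<T> \<Gamma>) n0" using translate_V_h0[OF n0] n0 by blast
  have unit: "norm (n0 z) = 1" if z: "z \<in> Z" for z
  proof -
    let ?p = "nodal_interp \<T> (\<lambda>x. (norm (n0 x))\<^sup>2 - 1)"
    have p: "?p \<in> V_h0 \<T> \<Gamma>" using interp n0' by blast
    have "(\<lambda>x. ?p x *\<^sub>R ?e) \<in> V_h \<T>"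
      by (rule V_h_linear_image[OF bounded_linear_scaleR_left nodal_interp_in_V_h])
    then have "(\<lambda>x. ?p x *\<^sub>R ?e) \<in> V_h0 \<T> \<Gamma>" using p by (simp add: V_h0_def)
    moreover have "\<forall>v\<in>V_h0 \<T> \<Gamma>. v z = (0::real^2)" using z by (simp add: Z_def)
    ultimately have "?p z *\<^sub>R ?e = 0" by (rule bspec[rotated])
    then have "?p z = 0" by (simp add: axis_eq_0_iff)
    then have "(norm (n0 z))\<^sup>2 = 1\<^sup>2" using z nodal_interp_at_node[of z "\<lambda>x. (norm (n0 x))\<^sup>2 - 1"] by (simp add: Z_def)
    then show ?thesis by (rule power2_eq_imp_eq) auto
  qed
  obtain n where n: "n \<in> V_h \<T>" and node: "\<And>z. z \<in> nodes \<T> \<Longrightarrow> n z = (if z \<in> Z then n0 z else ?e)"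
    using ex_nodal_interpolant[of "\<lambda>z. if z \<in> Z then n0 z else ?e"] by blast
  have "n x = n0 x" if x: "x \<in> \<Gamma>" for x
  proof -
    obtain T where T: "T \<in> \<T>" "x \<in> T" using x \<Gamma> by blast
    obtain \<alpha> where \<alpha>: "\<forall>z\<in>vertices T. 0 \<le> \<alpha> z" "sum \<alpha> (vertices T) = 1"
      "x = (\<Sum>z\<in>vertices T. \<alpha> z *\<^sub>R z)" using barycentric_coordinates[OF T] by blast
    have nodes: "z \<in> nodes \<T>" if "z \<in> vertices T" for z using that T(1) by (auto simp: nodes_eq)
    have "z \<in> Z" if z: "z \<in> vertices T" "\<alpha> z \<noteq> 0" for z
    proof -
      have "v z = 0" if v: "v \<in> V_h0 \<T> \<Gamma>" for v :: "real^2 \<Rightarrow> real^2"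
      proof -
        have sum0: "(\<Sum>y\<in>vertices T. \<alpha> y * ((norm (n0 y + s *\<^sub>R v y))\<^sup>2 - 1)) = 0" for s
        proof -
          let ?m = "\<lambda>y. n0 y + s *\<^sub>R v y"
          let ?p = "nodal_interp \<T> (\<lambda>x. (norm (?m x))\<^sup>2 - 1)"
          have "?m \<in> V_h \<T>"
            using v n0 V_h_linear_image[OF bounded_linear_scaleR_right, of v s]
            by (intro V_h_add) (auto simp: V_h0_def)
          then have "?m \<in> translate (V_h0 \<T> \<Gamma>) n0"
            unfolding translate_V_h0[OF n0] using v by (simp add: V_h0_def)
          then have "?p \<in> V_h0 \<T> \<Gamma>" by (rule interp[rule_format])
          then have "?p x = 0" using x by (simp add: V_h0_def)
          then have "0 = (\<Sum>y\<in>vertices T. \<alpha> y *\<^sub>R ?p y)"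
            unfolding \<alpha>(3) V_h_barycentric[OF nodal_interp_in_V_h T(1) \<alpha>(1,2)] by simp
          also have "\<dots> = (\<Sum>y\<in>vertices T. \<alpha> y * ((norm (?m y))\<^sup>2 - 1))"
            using nodes by (intro sum.cong refl) (simp add: nodal_interp_at_node)
          finally show ?thesis by simp
        qed
        \<comment> \<open>The second difference at \<open>s = 1, -1, 0\<close> removes the terms with \<open>n0\<close>.\<close>
        have parallelogram: "\<alpha> y * ((norm (n0 y + 1 *\<^sub>R v y))\<^sup>2 - 1)
            + \<alpha> y * ((norm (n0 y + (-1) *\<^sub>R v y))\<^sup>2 - 1) - 2 * (\<alpha> y * ((norm (n0 y + 0 *\<^sub>R v y))\<^sup>2 - 1))
            = 2 * (\<alpha> y * (norm (v y))\<^sup>2)" for y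
          by (simp add: power2_norm_eq_inner algebra_simps inner_commute)
        have "(\<Sum>y\<in>vertices T. 2 * (\<alpha> y * (norm (v y))\<^sup>2)) = 0"
          unfolding parallelogram[symmetric] sum.distrib sum_subtractf
          by (simp only: sum0 flip: sum_distrib_left)
        then have "2 * (\<alpha> z * (norm (v z))\<^sup>2) = 0"
          using \<alpha>(1) z(1) finite_vertices[OF T(1)] by (subst (asm) sum_nonneg_eq_0_iff) auto
        then show ?thesis using z(2) by simp
      qed
      then show ?thesis using nodes[OF z(1)] by (simp add: Z_def)
    qed
    then have "(\<Sum>z\<in>vertices T. \<alpha> z *\<^sub>R n z) = (\<Sum>z\<in>vertices T. \<alpha> z *\<^sub>R n0 z)"
      using nodes node by (intro sum.cong refl) fastforce
    then show ?thesis
      unfolding \<alpha>(3) V_h_barycentric[OF n T(1) \<alpha>(1,2)] V_h_barycentric[OF n0 T(1) \<alpha>(1,2)] .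
  qed
  moreover have "norm (n z) = 1" if "z \<in> nodes \<T>" for z
    using that node unit by simp
  ultimately have "n \<in> N_h \<Omega> \<T> \<Gamma> n0" using N_h_iff[OF n0 interp] n by blast
  then show ?thesis by blast
qed

lemma K_h_iff:
  assumes "u0 \<in> W_h \<T>"
  shows "u \<in> K_h \<Omega> \<T> \<Gamma> u0 \<longleftrightarrow> u \<in> W_h \<T> \<and> (\<forall>x\<in>\<Gamma>. u x = u0 x) \<and>
    (\<forall>q \<in> V_h \<T>. (LINT x:\<Omega>|lebesgue. q x * (det (def_grad u x) - 1)) = 0)"
  using translate_W_h0[OF assms] by (auto simp: K_h_def)

text \<open>The gradients converge pointwise and boundedly in the open triangles, so the determinant, a
polynomial in them, passes to the limit under the integral.\<close>

lemma K_h_closed: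
  assumes u0: "u0 \<in> W_h \<T>" and U: "\<And>k. U k \<in> K_h \<Omega> \<T> \<Gamma> u0" and lim: "fe_converges U u"
  shows "u \<in> K_h \<Omega> \<T> \<Gamma> u0"
  unfolding K_h_iff[OF u0]
proof (intro conjI ballI)
  have W: "U k \<in> W_h \<T>" and w: "u \<in> W_h \<T>" for k
    by (rule fe_convergesD[OF lim])+
  show "u \<in> W_h \<T>" by (rule w)
  show "u x = u0 x" if "x \<in> \<Gamma>" for x
  proof -
    have "U k x = u0 x" for k using U that K_h_iff[OF u0] by blast
    then have "(\<lambda>k. u0 x) \<longlonglongrightarrow> u x" using fe_convergesD(3)[OF lim, of x] by simp
    then show ?thesis by (simp add: LIMSEQ_const_iff)
  qed
  fix q :: "real^2 \<Rightarrow> real" assume q: "q \<in> V_h \<T>"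
  have cont_q: "continuous_on (closure \<Omega>) q" using q by (simp add: V_h_def Union_mesh)
  have "compact (closure \<Omega>)" using bounded_domain by (simp add: compact_closure)
  then have "bounded (q ` closure \<Omega>)"
    using cont_q by (intro compact_imp_bounded compact_continuous_image)
  then obtain Q where Q: "\<forall>y\<in>q ` closure \<Omega>. norm y \<le> Q" unfolding bounded_iff by (elim exE)
  obtain M where M: "\<And>k x. x \<in> cells \<Longrightarrow> norm (grad (U k) x) \<le> M"
    using fe_converges_grad_bound[OF lim] by blast
  have cells: "cells \<subseteq> closure \<Omega>" using cells_subset closure_subset by blast
  define \<Phi> where "\<Phi> p = fst p * (det (mat 1 + snd p) - 1)" for p :: "real \<times> (real^2^2)"
  have "(\<lambda>k. LINT x:\<Omega>|lebesgue. \<Phi> (q x, grad (U k) x)) \<longlonglongrightarrow> (LINT x:\<Omega>|lebesgue. \<Phi> (q x, grad u x))"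
  proof (rule cellwise_bounded_convergence[where \<Phi> = \<Phi> and M = "Q + M"
        and h = "\<lambda>k x. (q x, grad (U k) x)" and l = "\<lambda>x. (q x, grad u x)"])
    show "continuous_on cells (\<lambda>x. (q x, grad (U k) x))" for k
      by (intro continuous_on_Pair continuous_on_subset[OF cont_q cells] continuous_on_grad W)
    show "continuous_on cells (\<lambda>x. (q x, grad u x))"
      by (intro continuous_on_Pair continuous_on_subset[OF cont_q cells] continuous_on_grad w)
    show "(\<lambda>k. (q x, grad (U k) x)) \<longlonglongrightarrow> (q x, grad u x)" if "x \<in> cells" for x
      by (intro tendsto_intros fe_convergesD(4)[OF lim that])
    show "norm (q x, grad (U k) x) \<le> Q + M" if "x \<in> cells" for k x
      using Q M[OF that, of k] cells that norm_Pair_le[of "q x" "grad (U k) x"] by fastforce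
    show "continuous_on UNIV \<Phi>"
      unfolding \<Phi>_def det_2 by (intro continuous_intros)
  qed
  moreover have "(LINT x:\<Omega>|lebesgue. \<Phi> (q x, grad (U k) x)) = 0" for k
    using U[of k] q unfolding K_h_iff[OF u0] \<Phi>_def def_grad_def by simp
  ultimately show "(LINT x:\<Omega>|lebesgue. q x * (det (def_grad u x) - 1)) = 0"
    by (simp add: LIMSEQ_const_iff \<Phi>_def def_grad_def)
qed

section \<open>Compactness of energy sublevels\<close>

text \<open>With \<open>s\<^sub>k = 1\<close> this is continuity of the energy. With \<open>s\<^sub>k \<longlonglongrightarrow> 0\<close> it extracts the part of the energy that is
quadratic in an escaping displacement: the identity matrix, the director gradient and the loads
disappear from the limit.\<close>

lemma scaled_energy_tendsto:
  assumes f: "set_integrable lebesgue \<Omega> f" and g: "boundary_integrable \<Omega> \<T> \<Gamma> g"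
    and s: "s \<longlonglongrightarrow> \<sigma>" and U: "\<And>k. U k \<in> W_h \<T>"
    and lim_U: "fe_converges (\<lambda>k x. s k *\<^sub>R U k x) w" and lim_N: "fe_converges N n"
  shows "(\<lambda>k. (s k)\<^sup>2 * energy \<Omega> \<T> \<Gamma> a b f g (U k) (N k)) \<longlonglongrightarrow>
    (LINT x:\<Omega>|lebesgue. energy_density a b (\<sigma> *\<^sub>R mat 1 + grad w x) (n x) (\<sigma> *\<^sub>R grad n x))
    - \<sigma> * (LINT x:\<Omega>|lebesgue. f x \<bullet> w x) - \<sigma> * boundary_integral \<Omega> \<T> \<Gamma> (\<lambda>x. g x \<bullet> w x)"
proof -
  let ?V = "\<lambda>k x. s k *\<^sub>R U k x"
  have V: "?V k \<in> W_h \<T>" and w: "w \<in> W_h \<T>" for k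
    by (rule fe_convergesD[OF lim_U])+
  have N: "N k \<in> W_h \<T>" and n: "n \<in> W_h \<T>" for k
    by (rule fe_convergesD[OF lim_N])+
  have cont: "continuous_on cells v" if "v \<in> W_h \<T>" for v :: "real^2 \<Rightarrow> real^2"
  proof (rule continuous_on_subset)
    show "continuous_on (\<Union>\<T>) v" using that by (simp add: W_h_def)
    show "cells \<subseteq> \<Union>\<T>" using cells_subset closure_subset Union_mesh by blast
  qed
  define \<Phi> where "\<Phi> p = energy_density a b (fst p) (fst (snd p)) (snd (snd p))"
    for p :: "(real^2^2) \<times> (real^2) \<times> (real^2^2)"
  let ?h = "\<lambda>k x. (s k *\<^sub>R mat 1 + grad (?V k) x, N k x, s k *\<^sub>R grad (N k) x)"
  obtain M1 where M1: "\<And>k x. x \<in> cells \<Longrightarrow> norm (grad (?V k) x) \<le> M1"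
    using fe_converges_grad_bound[OF lim_U] by blast
  obtain M2 M3 where M2: "\<And>k x. norm (N k x) \<le> M2"
    and M3: "\<And>k x. x \<in> cells \<Longrightarrow> norm (grad (N k) x) \<le> M3"
    using fe_converges_bound[OF lim_N] fe_converges_grad_bound[OF lim_N] by metis
  obtain S where S: "\<And>k. \<bar>s k\<bar> \<le> S"
    using convergent_imp_bounded[OF s] by (auto simp: bounded_iff)
  have cont_h: "continuous_on cells (?h k)" for k
    by (intro continuous_intros continuous_on_grad V N cont)
  have "(\<lambda>k. LINT x:\<Omega>|lebesgue. \<Phi> (?h k x)) \<longlonglongrightarrow>
      (LINT x:\<Omega>|lebesgue. \<Phi> (\<sigma> *\<^sub>R mat 1 + grad w x, n x, \<sigma> *\<^sub>R grad n x))"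
  proof (rule cellwise_bounded_convergence[where \<Phi> = \<Phi> and h = ?h
        and l = "\<lambda>x. (\<sigma> *\<^sub>R mat 1 + grad w x, n x, \<sigma> *\<^sub>R grad n x)"
        and M = "(S * norm (mat 1 :: real^2^2) + M1) + (M2 + S * M3)"])
    show "continuous_on cells (?h k)" for k by (rule cont_h)
    show "continuous_on cells (\<lambda>x. (\<sigma> *\<^sub>R mat 1 + grad w x, n x, \<sigma> *\<^sub>R grad n x))"
      by (intro continuous_intros continuous_on_grad w n cont)
    show "(\<lambda>k. ?h k x) \<longlonglongrightarrow> (\<sigma> *\<^sub>R mat 1 + grad w x, n x, \<sigma> *\<^sub>R grad n x)" if "x \<in> cells" for x
      by (intro tendsto_intros s fe_convergesD(3)[OF lim_N] fe_convergesD(4)[OF lim_U that] fe_convergesD(4)[OF lim_N that])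
    show "norm (?h k x) \<le> (S * norm (mat 1 :: real^2^2) + M1) + (M2 + S * M3)" if x: "x \<in> cells" for k x
    proof -
      have "norm (s k *\<^sub>R mat 1 :: real^2^2) \<le> S * norm (mat 1 :: real^2^2)"
        using S by (simp add: mult_right_mono)
      then have "norm (s k *\<^sub>R mat 1 + grad (?V k) x) \<le> S * norm (mat 1 :: real^2^2) + M1"
        using M1[OF x, of k] by (intro norm_triangle_le add_mono)
      moreover have "norm (s k *\<^sub>R grad (N k) x) \<le> S * M3"
        using S[of k] M3[OF x, of k] by (auto intro!: mult_mono order_trans[OF abs_ge_zero S])
      ultimately show ?thesis
        using M2[of k x] by (intro order_trans[OF norm_Pair_le] add_mono)
    qed
    show "continuous_on UNIV \<Phi>"
      unfolding \<Phi>_def by (intro continuous_on_energy_density continuous_intros)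
  qed
  moreover have "(LINT x:\<Omega>|lebesgue. \<Phi> (?h k x)) =
      (s k)\<^sup>2 * (LINT x:\<Omega>|lebesgue. energy_density a b (def_grad (U k) x) (N k x) (grad (N k) x))" for k
  proof -
    have "(LINT x:\<Omega>|lebesgue. \<Phi> (?h k x)) = (LINT x:\<Omega>|lebesgue.
        (s k)\<^sup>2 * energy_density a b (def_grad (U k) x) (N k x) (grad (N k) x))"
    proof (rule cellwise_integral_cong)
      show "continuous_on cells (\<lambda>x. \<Phi> (?h k x))"
        unfolding \<Phi>_def fst_conv snd_conv
        by (intro continuous_on_energy_density continuous_intros continuous_on_grad V N cont)
      fix x assume x: "x \<in> cells"
      show "\<Phi> (?h k x) = (s k)\<^sup>2 * energy_density a b (def_grad (U k) x) (N k x) (grad (N k) x)"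
        unfolding \<Phi>_def fst_conv snd_conv grad_scaleR[OF U x] def_grad_def
        by (simp flip: energy_density_scaleR scaleR_add_right)
    qed
    then show ?thesis by simp
  qed
  ultimately have density: "(\<lambda>k. (s k)\<^sup>2 * (LINT x:\<Omega>|lebesgue. energy_density a b (def_grad (U k) x) (N k x) (grad (N k) x)))
      \<longlonglongrightarrow> (LINT x:\<Omega>|lebesgue. energy_density a b (\<sigma> *\<^sub>R mat 1 + grad w x) (n x) (\<sigma> *\<^sub>R grad n x))"
    by (simp add: \<Phi>_def)
  have body: "(LINT x:\<Omega>|lebesgue. f x \<bullet> ?V k x) = s k * (LINT x:\<Omega>|lebesgue. f x \<bullet> U k x)" for k
    by simp
  have boundary: "boundary_integral \<Omega> \<T> \<Gamma> (\<lambda>x. g x \<bullet> ?V k x) = s k * boundary_integral \<Omega> \<T> \<Gamma> (\<lambda>x. g x \<bullet> U k x)" for k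
    by (simp add: boundary_integral_def sum_distrib_left)
  have "(s k)\<^sup>2 * energy \<Omega> \<T> \<Gamma> a b f g (U k) (N k) =
      (s k)\<^sup>2 * (LINT x:\<Omega>|lebesgue. energy_density a b (def_grad (U k) x) (N k x) (grad (N k) x))
      - s k * (LINT x:\<Omega>|lebesgue. f x \<bullet> ?V k x) - s k * boundary_integral \<Omega> \<T> \<Gamma> (\<lambda>x. g x \<bullet> ?V k x)" for k
    unfolding body boundary energy_def energy_density_def by (simp add: power2_eq_square algebra_simps)
  then show ?thesis
    using density s body_integral_tendsto[OF f lim_U] boundary_integral_tendsto[OF g lim_U]
    by (simp only:) (intro tendsto_intros)
qed

text \<open>The function is constant on each triangle, so it takes finitely many values on the connected
domain; being continuous, it takes only one.\<close>

lemma W_h_zero_gradient: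
  assumes conn: "connected \<Omega>" and w: "w \<in> W_h \<T>" and 0: "\<And>x. x \<in> cells \<Longrightarrow> grad w x = 0"
    and z: "z \<in> closure \<Omega>" "w z = 0"
  shows "w x = 0"
proof -
  have cont: "continuous_on (closure \<Omega>) w" using w by (simp add: W_h_def Union_mesh)
  have "\<exists>c. \<forall>x\<in>T. w x = c" if T: "T \<in> \<T>" for T
  proof -
    have "(w has_derivative (\<lambda>h. 0)) (at x within interior T)" if "x \<in> interior T" for x
    proof -
      have x: "x \<in> cells" using T that by (auto simp: cells_def)
      show ?thesis using grad_works[OF w x] 0[OF x] by (simp add: has_derivative_at_withinI)
    qed
    then obtain c where c: "\<And>x. x \<in> interior T \<Longrightarrow> w x = c"
      using has_derivative_zero_constant[OF convex_interior[OF convex_triangle[OF T]], of w] by blast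
    have closure: "closure (interior T) = T"
      using convex_closure_interior[OF convex_triangle[OF T] interior_triangle_nonempty[OF T]]
        closure_closed[OF compact_imp_closed[OF compact_triangle[OF T]]] by simp
    have "continuous_on (closure (interior T)) w"
      unfolding closure using cont T Union_mesh by (auto intro: continuous_on_subset)
    from continuous_constant_on_closure[OF this c] show ?thesis unfolding closure by blast
  qed
  then obtain c where c: "\<And>T x. T \<in> \<T> \<Longrightarrow> x \<in> T \<Longrightarrow> w x = c T" by metis
  have zero_component: "w y $ i = 0" if y: "y \<in> closure \<Omega>" for y i
  proof -
    have "\<Omega> \<subseteq> \<Union>\<T>" using closure_subset Union_mesh by blast
    then have "(\<lambda>x. w x $ i) ` \<Omega> \<subseteq> (\<lambda>T. c T $ i) ` \<T>" using c by fastforce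
    then have "finite ((\<lambda>x. w x $ i) ` \<Omega>)" using finite_mesh finite_surj by blast
    moreover have "continuous_on \<Omega> (\<lambda>x. w x $ i)"
      by (intro continuous_intros continuous_on_subset[OF cont] closure_subset)
    ultimately have "(\<lambda>x. w x $ i) constant_on \<Omega>"
      using continuous_finite_range_constant[OF conn] by blast
    then obtain d where d: "\<And>x. x \<in> \<Omega> \<Longrightarrow> w x $ i = d"
      unfolding constant_on_def by blast
    have "continuous_on (closure \<Omega>) (\<lambda>x. w x $ i)" by (intro continuous_intros cont)
    from continuous_constant_on_closure[OF this d] have "w x $ i = d" if "x \<in> closure \<Omega>" for x
      using that by blast
    from this[OF y] this[OF z(1)] show ?thesis using z(2) by simp
  qed
  show ?thesis
  proof (cases "x \<in> closure \<Omega>")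
    case True
    then show ?thesis using zero_component by (simp add: vec_eq_iff)
  next
    case False
    then show ?thesis using w by (simp add: W_h_def Union_mesh)
  qed
qed

text \<open>Escape is impossible because directors are bounded by one everywhere: multiples with factors
tending to zero converge to zero.\<close>

lemma N_h_sequentially_compact:
  assumes n0: "n0 \<in> V_h \<T>"
    and interp: "\<forall>n \<in> translate (V_h0 \<T> \<Gamma>) n0. nodal_interp \<T> (\<lambda>x. (norm (n x))\<^sup>2 - 1) \<in> V_h0 \<T> \<Gamma>"
    and N: "\<And>k::nat. N k \<in> N_h \<Omega> \<T> \<Gamma> n0"
  shows "\<exists>r n. strict_mono r \<and> n \<in> N_h \<Omega> \<T> \<Gamma> n0 \<and> fe_converges (\<lambda>k. N (r k)) n"
proof -
  note iff = N_h_iff[OF n0 interp]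
  have V: "N k \<in> V_h \<T>" and on_\<Gamma>: "x \<in> \<Gamma> \<Longrightarrow> N k x = n0 x"
    and unit: "z \<in> nodes \<T> \<Longrightarrow> norm (N k z) = 1" for k x z
    using iffD1[OF iff N[of k]] by auto
  have le1: "norm (N k x) \<le> 1" for k x
  proof (cases "x \<in> \<Union>\<T>")
    case True
    then show ?thesis by (rule V_h_norm_le[OF V, rotated]) (simp add: unit)
  next
    case False
    then show ?thesis using V[of k] by (simp add: V_h_def)
  qed
  have "\<forall>k. N k \<in> W_h \<T>" using V V_h_subset_W_h by blast
  then show ?thesis
  proof (cases rule: fe_compactness_alternative)
    case (convergent r n)
    have lim: "(\<lambda>k. N (r k) x) \<longlonglongrightarrow> n x" for x by (rule fe_convergesD[OF convergent(2)])
    have "n \<in> V_h \<T>" using V lim by (rule V_h_limit)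
    moreover have "n x = n0 x" if "x \<in> \<Gamma>" for x
      using lim[of x] on_\<Gamma>[OF that] by (simp add: LIMSEQ_const_iff)
    moreover have "norm (n z) = 1" if "z \<in> nodes \<T>" for z
      using tendsto_norm[OF lim[of z]] unit[OF that] by (simp add: LIMSEQ_const_iff)
    ultimately show ?thesis using convergent iff by blast
  next
    case (escaping r s w)
    have "w x = 0" for x
    proof -
      have "(\<lambda>k. s k *\<^sub>R N (r k) x) \<longlonglongrightarrow> 0"
      proof (rule Lim_null_comparison[OF _ escaping(3)])
        show "\<forall>\<^sub>F k in sequentially. norm (s k *\<^sub>R N (r k) x) \<le> s k"
          using le1 escaping(2) by (auto intro!: always_eventually mult_left_le simp: less_imp_le abs_of_pos)
      qed
      moreover have "(\<lambda>k. s k *\<^sub>R N (r k) x) \<longlonglongrightarrow> w x" by (rule fe_convergesD[OF escaping(4)])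
      ultimately show ?thesis using LIMSEQ_unique by blast
    qed
    then show ?thesis using escaping(5) by blast
  qed
qed

text \<open>Discrete coercivity by contradiction, in place of a Poincare inequality: the rescaled limit \<open>w\<close> of an
escaping sequence with energies bounded above has zero gradient and vanishes at \<open>z\<close>.\<close>

lemma K_h_sequentially_compact:
  assumes conn: "connected \<Omega>" and \<Gamma>0: "z \<in> \<Gamma>0" "z \<in> closure \<Omega>"
    and a: "0 < a" "a \<le> 1"
    and f: "set_integrable lebesgue \<Omega> f" and g: "boundary_integrable \<Omega> \<T> \<Gamma> g"
    and u0: "u0 \<in> W_h \<T>" and U: "\<And>k::nat. U k \<in> K_h \<Omega> \<T> \<Gamma>0 u0"
    and N: "fe_converges N n" and n_le: "\<And>x. norm (n x) \<le> 1"
    and le: "\<And>k. energy \<Omega> \<T> \<Gamma> a b f g (U k) (N k) \<le> C"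
  shows "\<exists>r u. strict_mono r \<and> u \<in> K_h \<Omega> \<T> \<Gamma>0 u0 \<and> fe_converges (\<lambda>k. U (r k)) u"
proof -
  have W: "U k \<in> W_h \<T>" for k using U K_h_iff[OF u0] by blast
  then have "\<forall>k. U k \<in> W_h \<T>" by blast
  then show ?thesis
  proof (cases rule: fe_compactness_alternative)
    case (convergent r u)
    then show ?thesis using K_h_closed[OF u0 U] by blast
  next
    case (escaping r s w)
    have w: "w \<in> W_h \<T>" by (rule fe_convergesD[OF escaping(4)])
    have n: "n \<in> W_h \<T>" by (rule fe_convergesD[OF N])
    let ?\<phi> = "\<lambda>x. energy_density a b (grad w x) (n x) 0"
    have "(\<lambda>k. (s k)\<^sup>2 * energy \<Omega> \<T> \<Gamma> a b f g (U (r k)) (N (r k))) \<longlonglongrightarrow> (LINT x:\<Omega>|lebesgue. ?\<phi> x)"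
      using scaled_energy_tendsto[OF f g escaping(3) W escaping(4) fe_converges_subseq[OF N escaping(1)]]
      by simp
    moreover have "(\<lambda>k. (s k)\<^sup>2 * C) \<longlonglongrightarrow> 0\<^sup>2 * C" by (intro tendsto_intros escaping(3))
    moreover have "(s k)\<^sup>2 * energy \<Omega> \<T> \<Gamma> a b f g (U (r k)) (N (r k)) \<le> (s k)\<^sup>2 * C" for k
      using le by (intro mult_left_mono) auto
    ultimately have int: "(LINT x:\<Omega>|lebesgue. ?\<phi> x) \<le> 0" using LIMSEQ_le by fastforce
    have cont_w: "continuous_on cells (grad w)" by (rule continuous_on_grad[OF w])
    have cont_n: "continuous_on cells n"
    proof (rule continuous_on_subset)
      show "continuous_on (\<Union>\<T>) n" using n by (simp add: W_h_def)
      show "cells \<subseteq> \<Union>\<T>" using cells_subset closure_subset Union_mesh by blast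
    qed
    have cont: "continuous_on cells ?\<phi>"
      by (intro continuous_on_energy_density cont_w cont_n continuous_intros)
    obtain M where M: "\<And>k x. x \<in> cells \<Longrightarrow> norm (grad (\<lambda>x. s k *\<^sub>R U (r k) x) x) \<le> M"
      using fe_converges_grad_bound[OF escaping(4)] by blast
    have M': "norm (grad w x) \<le> M" if "x \<in> cells" for x
      using M[OF that] by (intro LIMSEQ_le_const2[OF tendsto_norm[OF fe_convergesD(4)[OF escaping(4) that]]]) auto
    have coercive: "a * (norm (grad w x))\<^sup>2 \<le> ?\<phi> x" for x
      using a(2) n_le by (rule energy_density_coercive)
    have "?\<phi> x = 0" if "x \<in> cells" for x
    proof (rule continuous_nonneg_integral_eq_0[OF open_cells _ cont _ _ _ that])
      show "bounded cells" using bounded_domain cells_subset bounded_subset by blast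
      show "0 \<le> ?\<phi> x" for x using coercive[of x] a(1) by (intro order_trans[OF _ coercive]) simp
      show "?\<phi> x \<le> M\<^sup>2" if "x \<in> cells" for x
      proof -
        have "?\<phi> x \<le> (norm (grad w x))\<^sup>2" using a(2) by (simp add: energy_density_def)
        also have "\<dots> \<le> M\<^sup>2" using M'[OF that] by (simp add: power_mono)
        finally show ?thesis .
      qed
      show "(LINT x:cells|lebesgue. ?\<phi> x) \<le> 0"
        using int cellwise_continuous_measurable(2)[OF cont] by simp
    qed
    then have grad0: "grad w x = 0" if "x \<in> cells" for x
      using coercive[of x] a(1) that by (simp add: mult_le_0_iff)
    have "w z = 0"
    proof -
      have "U k z = u0 z" for k using U K_h_iff[OF u0] \<Gamma>0(1) by blast
      then have "(\<lambda>k. s k *\<^sub>R u0 z) \<longlonglongrightarrow> w z" using fe_convergesD(3)[OF escaping(4), of z] by simp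
      moreover have "(\<lambda>k. s k *\<^sub>R u0 z) \<longlonglongrightarrow> 0 *\<^sub>R u0 z" by (intro tendsto_intros escaping(3))
      ultimately show ?thesis using LIMSEQ_unique by fastforce
    qed
    then have "w x = 0" for x using W_h_zero_gradient[OF conn w grad0 \<Gamma>0(2)] by blast
    then show ?thesis using escaping(5) by blast
  qed
qed

end

section \<open>Existence of minimizers\<close>

theorem theorem12:
  fixes \<Omega> \<Gamma>0 \<Gamma>1 \<Gamma>2 :: "(real^2) set" and \<T> :: "(real^2) set set"
    and a b :: real
    and f g u0 n0 :: "real^2 \<Rightarrow> real^2"
  assumes domain: "open \<Omega>" "connected \<Omega>" "\<Omega> \<noteq> {}"
    and mesh: "triangular_mesh \<Omega> \<T>"
    and boundary_parts: "\<Gamma>0 \<subseteq> frontier \<Omega>" "\<Gamma>1 \<subseteq> frontier \<Omega>" "\<Gamma>2 \<subseteq> frontier \<Omega>"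
    and \<Gamma>0_nonempty: "\<Gamma>0 \<noteq> {}"
    and \<Gamma>2_borel: "\<Gamma>2 \<in> sets borel"
    and a: "0 < a" "a < 1"
    and f: "set_integrable lebesgue \<Omega> f"
    and g: "boundary_integrable \<Omega> \<T> \<Gamma>2 g"
    and u0: "u0 \<in> W_h \<T>"
    and n0: "n0 \<in> V_h \<T>"
    and interp_in_V_h0:
      "\<forall>n \<in> translate (V_h0 \<T> \<Gamma>1) n0. nodal_interp \<T> (\<lambda>x. (norm (n x))\<^sup>2 - 1) \<in> V_h0 \<T> \<Gamma>1"
    and K_h_nonempty: "K_h \<Omega> \<T> \<Gamma>0 u0 \<noteq> {}"
  shows "\<exists>(u, n) \<in> K_h \<Omega> \<T> \<Gamma>0 u0 \<times> N_h \<Omega> \<T> \<Gamma>1 n0.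
           \<forall>(u', n') \<in> K_h \<Omega> \<T> \<Gamma>0 u0 \<times> N_h \<Omega> \<T> \<Gamma>1 n0.
             energy \<Omega> \<T> \<Gamma>2 a b f g u n \<le> energy \<Omega> \<T> \<Gamma>2 a b f g u' n'"
proof -
  interpret planar_mesh \<Omega> \<T> by unfold_locales (rule mesh)
  let ?K = "K_h \<Omega> \<T> \<Gamma>0 u0" and ?N = "N_h \<Omega> \<T> \<Gamma>1 n0"
  let ?E = "energy \<Omega> \<T> \<Gamma>2 a b f g"
  obtain z where z: "z \<in> \<Gamma>0" "z \<in> closure \<Omega>"
    using \<Gamma>0_nonempty boundary_parts(1) by (auto simp: frontier_def)
  have "\<Gamma>1 \<subseteq> \<Union>\<T>" using boundary_parts(2) by (auto simp: frontier_def Union_mesh)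
  then have "?N \<noteq> {}" using interp_in_V_h0 by (rule N_h_nonempty[OF n0])
  then have "?K \<times> ?N \<noteq> {}" using K_h_nonempty by blast
  then have "\<exists>p\<in>?K \<times> ?N. \<forall>q\<in>?K \<times> ?N. (\<lambda>(u, n). ?E u n) p \<le> (\<lambda>(u, n). ?E u n) q"
  proof (rule ex_minimizer_of_compact_sublevels)
    fix X :: "nat \<Rightarrow> (real^2 \<Rightarrow> real^2) \<times> (real^2 \<Rightarrow> real^2)" and C
    assume X: "\<And>k. X k \<in> ?K \<times> ?N" and le: "\<And>k. (case X k of (u, n) \<Rightarrow> ?E u n) \<le> C"
    have U: "fst (X k) \<in> ?K" and N: "snd (X k) \<in> ?N" for k using X[of k] by (auto simp: mem_Times_iff)
    have "\<exists>r n. strict_mono r \<and> n \<in> ?N \<and> fe_converges (\<lambda>k. snd (X (r k))) n"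
      by (rule N_h_sequentially_compact[OF n0 interp_in_V_h0]) (rule N)
    then obtain r n where r: "strict_mono r" and n: "n \<in> ?N"
      and lim_N: "fe_converges (\<lambda>k. snd (X (r k))) n" by (elim exE conjE)
    have n_le: "norm (n x) \<le> 1" for x
    proof (cases "x \<in> \<Union>\<T>")
      case True
      have n': "n \<in> V_h \<T>" "\<forall>z\<in>nodes \<T>. norm (n z) = 1"
        using iffD1[OF N_h_iff[OF n0 interp_in_V_h0] n] by auto
      show ?thesis by (rule V_h_norm_le[OF n'(1) _ True]) (simp add: n'(2))
    next
      case False
      then show ?thesis using fe_convergesD(2)[OF lim_N] by (simp add: W_h_def)
    qed
    have "\<exists>p u. strict_mono p \<and> u \<in> ?K \<and> fe_converges (\<lambda>k. fst (X (r (p k)))) u"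
      using domain(2) z a(1) less_imp_le[OF a(2)] f g u0 U lim_N n_le
    proof (rule K_h_sequentially_compact)
      show "?E (fst (X (r k))) (snd (X (r k))) \<le> C" for k using le[of "r k"] by (simp add: split_beta)
    qed
    then obtain p u where p: "strict_mono p" and u: "u \<in> ?K"
      and lim_U: "fe_converges (\<lambda>k. fst (X (r (p k)))) u" by blast
    have "(\<lambda>k. 1\<^sup>2 * ?E (fst (X (r (p k)))) (snd (X (r (p k))))) \<longlonglongrightarrow>
      (LINT x:\<Omega>|lebesgue. energy_density a b (1 *\<^sub>R mat 1 + grad u x) (n x) (1 *\<^sub>R grad n x))
      - 1 * (LINT x:\<Omega>|lebesgue. f x \<bullet> u x) - 1 * boundary_integral \<Omega> \<T> \<Gamma>2 (\<lambda>x. g x \<bullet> u x)"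
      using lim_U by (intro scaled_energy_tendsto f g fe_converges_subseq[OF lim_N p] fe_convergesD(1)[OF lim_U]) auto
    then have "(\<lambda>k. ?E (fst (X (r (p k)))) (snd (X (r (p k))))) \<longlonglongrightarrow> ?E u n"
      by (simp add: energy_def energy_density_def def_grad_def)
    then show "\<exists>r x. strict_mono r \<and> x \<in> ?K \<times> ?N \<and>
        (\<lambda>k. case X (r k) of (u, n) \<Rightarrow> ?E u n) \<longlonglongrightarrow> (case x of (u, n) \<Rightarrow> ?E u n)"
      using u n strict_mono_o[OF r p]
      by (intro exI[of _ "\<lambda>k. r (p k)"] exI[of _ "(u, n)"]) (auto simp: split_beta o_def)
  qed
  then show ?thesis by (auto simp: split_beta)
qed

end
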